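(* Let $X$ be a set of infinite cardinality $\kappa$. If $\kappa$ is regular, then the symmetric precomplete submonoids of $\mathcal{O}^{(1)}$ are exactly the monoid $\mathcal{A}$ and the monoids $\mathcal{G}_\lambda$ and $\mathcal{M}_\lambda$, where $\lambda$ ranges over $\lambda=1$ and all cardinals $\aleph_0\le\lambda\le\kappa$. If $\kappa$ is singular, then the symmetric precomplete submonoids of $\mathcal{O}^{(1)}$ are exactly the monoid $\mathcal{A}'$ and the monoids $\mathcal{G}_\lambda$ and $\mathcal{M}_\lambda$, where $\lambda$ ranges over $\lambda=1$ and all cardinals $\aleph_0\le\lambda\le\kappa$.
   Context: $\mathcal{O}^{(1)}$ is the full transformation monoid of all functions $X\to X$ under composition. A submonoid of $\mathcal{O}^{(1)}$ (also called a unary clone) is precomplete iff it is a dual atom in the lattice of submonoids of $\mathcal{O}^{(1)}$ ordered by inclusion. Let $\mathcal{S}$ be the set of all permutations of $X$. A submonoid $\mathcal{G}$ is symmetric iff it is closed under conjugation: $\mathcal{G}=\{\gamma^{-1}\circ f\circ\gamma : f\in\mathcal{G},\ \gamma\in\mathcal{S}\}$. A subset $S\subseteq X$ is small iff $|S|<|X|$ and co-small iff $X\setminus S$ is small. A property holds for almost all $x\in X$ iff there is a co-small $S\subseteq X$ such that it holds for all $x\in S$. For a cardinal $1\le\lambda\le|X|$, a function $f\in\mathcal{O}^{(1)}$ is $\lambda$-injective iff there exists $A\subseteq X$ with $|A|<\lambda$ such that the restriction of $f$ to $X\setminus A$ is injective; $f$ is $\lambda$-surjective iff $|X\setminus f[X]|<\lambda$.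 Define $\mathcal{A}=\{f\in\mathcal{O}^{(1)} : f^{-1}[\{y\}]\text{ is small for almost all }y\in X\}$; $\mathcal{A}'=\{f\in\mathcal{O}^{(1)} : \text{there is a cardinal }\mu<\kappa\text{ such that }|f^{-1}[\{x\}]|\le\mu\text{ for almost all }x\in X\}$; $\mathcal{G}_\lambda=\{f\in\mathcal{O}^{(1)} : \text{if }A\subseteq X\text{ has cardinality }\lambda\text{ then }|X\setminus f[X\setminus A]|\ge\lambda\}$; $\mathcal{M}_\lambda=\{f\in\mathcal{O}^{(1)} : f\text{ is }\lambda\text{-surjective or not }\lambda\text{-injective}\}$. *)

theory Defs
  imports "HOL-Algebra.Group"
begin

unbundle cardinal_syntax

text \<open>
  The base set \<open>X\<close> is the universe of a type \<open>'a\<close> (assumed infinite in the theorem). A cardinal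
  is a cardinal order, up to order isomorphism \<open>=o\<close>. Every cardinal \<open>\<le> |X|\<close> is realised by a
  cardinal order of type \<^typ>\<open>'a rel\<close>, because a subset of \<open>X\<close> of that size can serve as its
  field; so such cardinals may be quantified over within \<^typ>\<open>'a rel\<close>.
\<close>

definition full_trans_monoid :: "('a \<Rightarrow> 'a) monoid" where
  "full_trans_monoid = \<lparr>carrier = UNIV, mult = (\<circ>), one = id\<rparr>"

definition precomplete :: "('a \<Rightarrow> 'a) set \<Rightarrow> bool" where
  "precomplete G \<longleftrightarrow>
     submonoid G full_trans_monoid \<and> G \<subset> carrier full_trans_monoid \<and>
     \<not> (\<exists>H. submonoid H full_trans_monoid \<and> G \<subset> H \<and> H \<subset> carrier full_trans_monoid)"

definition symmetric :: "('a \<Rightarrow> 'a) set \<Rightarrow> bool" where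
  "symmetric G \<longleftrightarrow> G = {inv_into UNIV \<gamma> \<circ> f \<circ> \<gamma> | f \<gamma>. f \<in> G \<and> bij \<gamma>}"

definition small :: "'a set \<Rightarrow> bool" where
  "small S \<longleftrightarrow> |S| <o |UNIV :: 'a set|"

definition co_small :: "'a set \<Rightarrow> bool" where
  "co_small S \<longleftrightarrow> small (UNIV - S)"

definition almost_all :: "('a \<Rightarrow> bool) \<Rightarrow> bool" where
  "almost_all P \<longleftrightarrow> (\<exists>S. co_small S \<and> (\<forall>x\<in>S. P x))"

definition card_injective :: "'b rel \<Rightarrow> ('a \<Rightarrow> 'a) \<Rightarrow> bool" where
  "card_injective \<nu> f \<longleftrightarrow> (\<exists>A. |A| <o \<nu> \<and> inj_on f (UNIV - A))"

definition card_surjective :: "'b rel \<Rightarrow> ('a \<Rightarrow> 'a) \<Rightarrow> bool" where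
  "card_surjective \<nu> f \<longleftrightarrow> |UNIV - range f| <o \<nu>"

definition monoid_A :: "('a \<Rightarrow> 'a) set" where
  "monoid_A = {f. almost_all (\<lambda>y. small (f -` {y}))}"

definition monoid_A' :: "('a \<Rightarrow> 'a) set" where
  "monoid_A' =
     {f. \<exists>\<mu> :: 'a rel. Card_order \<mu> \<and> \<mu> <o |UNIV :: 'a set| \<and>
          almost_all (\<lambda>x. |f -` {x}| \<le>o \<mu>)}"

definition monoid_G :: "'b rel \<Rightarrow> ('a \<Rightarrow> 'a) set" where
  "monoid_G \<nu> = {f. \<forall>A. |A| =o \<nu> \<longrightarrow> \<nu> \<le>o |UNIV - f ` (UNIV - A)|}"

definition monoid_M :: "'b rel \<Rightarrow> ('a \<Rightarrow> 'a) set" where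
  "monoid_M \<nu> = {f. card_surjective \<nu> f \<or> \<not> card_injective \<nu> f}"

definition index_cardinals :: "'a rel set" where
  "index_cardinals =
     {\<nu>. Card_order \<nu> \<and> (\<nu> =o cone \<or> natLeq \<le>o \<nu> \<and> \<nu> \<le>o |UNIV :: 'a set| )}"

end

(*
  A submonoid that contains all permutations and avoids every M_lambda contains injections whose
  range omits larger and larger sets, by induction on the size of the set omitted: a lambda-injective
  map is made injective by precomposing an injection that avoids the exceptional set. Dually, avoiding
  every G_lambda yields surjections that remain onto after deleting a large set; combined with a
  map outside A (or A') they yield a surjection s all of whose fibres have size |X|. If i is an injection
  whose range has a complement of size |X|, then every function is s o pi o i for some permutation pi.

  A symmetric precomplete monoid contains all permutations: otherwise the products g o pi would form
  a larger monoid, hence all of O^(1), so that it would contain an injection with large co-range and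
  a left inverse of such an injection. Conjugates of these generate every permutation.
*)

theory Submission
  imports Defs "HOL-Combinatorics.Transposition"
begin

text \<open>One fact serves both directions: a monoid that contains all permutations and lies in no
  listed monoid is everything. For a symmetric precomplete monoid it yields a listed monoid above
  it; for a monoid strictly above a listed one it yields maximality, once the list is known to be an
  antichain. Regularity decides between \<open>monoid_A\<close> and \<open>monoid_A'\<close> because
  a fibre of a composite is a union of fibres: at a singular cardinal a small union of small sets
  can be large, whereas a uniform bound on the fibres survives. In return, a function outside
  \<open>monoid_A'\<close> need not have large fibres, only fibres of sizes unbounded below |X|;
  composing it with itself around a suitable permutation adds these up to large ones. Only 1 and
  infinite cardinals occur as indices, because "fewer than lambda points" has to be stable under
  unions of two sets. A partial bijection extends to a permutation as soon as both complements have
  size |X|. This is why large sets are halved again and again: one half is used, the other is kept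
  as free space.\<close>

lemma ordLeq_subset:
  assumes "|A| \<le>o |B|"
  obtains C where "C \<subseteq> B" "|C| =o |A|"
proof -
  obtain f where f: "inj_on f A" "f ` A \<subseteq> B"
    using assms card_of_ordLeq[of A B] by blast
  then have "|A| =o |f ` A|"
    using inj_on_imp_bij_betw card_of_ordIso by blast
  then show thesis using that f(2) ordIso_symmetric by blast
qed

lemma ordLeq_iff_not_ordLess: "\<not> |A| <o |B| \<longleftrightarrow> |B| \<le>o |A|"
  using not_ordLess_iff_ordLeq[OF card_of_Well_order card_of_Well_order] .

lemma card_of_finite_ordLess: "finite A \<Longrightarrow> infinite B \<Longrightarrow> |A| <o |B|"
  using card_of_ordLeq_finite[of B A] ordLeq_iff_not_ordLess by blast

section \<open>Small sets, and extending partial bijections to permutations\<close>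

lemma small_subset: "small T \<Longrightarrow> S \<subseteq> T \<Longrightarrow> small S"
  unfolding small_def using card_of_mono1 ordLeq_ordLess_trans by blast

lemma not_small_iff: "\<not> small (S :: 'a set) \<longleftrightarrow> |UNIV :: 'a set| \<le>o |S|"
  unfolding small_def by (rule ordLeq_iff_not_ordLess)

lemma not_small_ordIso: "\<not> small (S :: 'a set) \<longleftrightarrow> |S| =o |UNIV :: 'a set|"
  unfolding not_small_iff ordIso_iff_ordLeq by (simp add: card_of_mono1)

lemma small_ordLeq:
  fixes S T :: "'a set"
  shows "small T \<Longrightarrow> |S| \<le>o |T| \<Longrightarrow> small S"
  unfolding small_def using ordLeq_ordLess_trans by blast

lemma small_ordLess:
  fixes S T :: "'a set"
  shows "|S| <o |T| \<Longrightarrow> small S"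
  unfolding small_def using card_of_mono1[of T UNIV] ordLess_ordLeq_trans by blast

lemma small_image:
  fixes f :: "'a \<Rightarrow> 'a"
  shows "small S \<Longrightarrow> small (f ` S)"
  using small_ordLeq card_of_image by blast

lemma not_small_ordIso_both:
  fixes S T :: "'a set"
  assumes "\<not> small S" "\<not> small T"
  shows "|S| =o |T|"
  using assms unfolding not_small_ordIso using ordIso_symmetric ordIso_transitive by blast

lemma not_small_inj_image:
  fixes f :: "'a \<Rightarrow> 'a"
  assumes "\<not> small S" "inj_on f S"
  shows "\<not> small (f ` S)"
proof -
  have "|S| \<le>o |f ` S|" using assms(2) card_of_ordLeq by blast
  then show ?thesis using assms(1) small_ordLeq by blast
qed

lemma not_small_UNIV: "\<not> small UNIV"
  unfolding not_small_iff by (rule card_of_mono1) simp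

lemma not_small_range:
  fixes f :: "'a \<Rightarrow> 'a"
  shows "inj f \<Longrightarrow> \<not> small (range f)"
  by (rule not_small_inj_image[OF not_small_UNIV])

text \<open>The two complements have the same size |X|, so any bijection between them completes
  \<open>f\<close>.\<close>

lemma bij_extend:
  fixes f :: "'a \<Rightarrow> 'a"
  assumes f: "bij_betw f A B" and "\<not> small (- A)" "\<not> small (- B)"
  obtains \<pi> where "bij \<pi>" "\<And>x. x \<in> A \<Longrightarrow> \<pi> x = f x"
proof -
  obtain g where g: "bij_betw g (- A) (- B)"
    using not_small_ordIso_both[OF assms(2,3)] card_of_ordIso by blast
  have 1: "bij_betw (\<lambda>x. if x \<in> A then f x else g x) A B"
    using f by (rule bij_betw_cong[THEN iffD1, rotated]) simp
  have 2: "bij_betw (\<lambda>x. if x \<in> A then f x else g x) (- A) (- B)"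
    using g by (rule bij_betw_cong[THEN iffD1, rotated]) simp
  have "bij_betw (\<lambda>x. if x \<in> A then f x else g x) (A \<union> - A) (B \<union> - B)"
    using 1 2 by (rule bij_betw_combine) simp
  then have "bij (\<lambda>x. if x \<in> A then f x else g x)" by simp
  then show thesis by (rule that) simp
qed

lemma bij_carrying:
  fixes A B :: "'a set"
  assumes "|A| =o |B|" and "\<not> small (- A)" "\<not> small (- B)"
  obtains \<pi> where "bij \<pi>" "\<pi> ` A = B"
proof -
  obtain f where f: "bij_betw f A B" using assms(1) card_of_ordIso by blast
  obtain \<pi> where p: "bij \<pi>" "\<And>x. x \<in> A \<Longrightarrow> \<pi> x = f x"
    using bij_extend[OF f assms(2,3)] by blast
  have "\<pi> ` A = f ` A" using p(2) by force
  then show thesis using that p(1) f by (simp add: bij_betw_def)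
qed

lemma inj_into_not_small:
  fixes S :: "'a set"
  assumes "\<not> small S"
  obtains h :: "'a \<Rightarrow> 'a" where "inj h" "range h \<subseteq> S"
  using assms unfolding not_small_iff using card_of_ordLeq[of "UNIV::'a set" S] by blast

context
  assumes inf: "infinite (UNIV :: 'a set)"
begin

lemma small_Un: "small (S :: 'a set) \<Longrightarrow> small T \<Longrightarrow> small (S \<union> T)"
  unfolding small_def by (rule card_of_Un_ordLess_infinite[OF inf])

lemma finite_small: "finite (S :: 'a set) \<Longrightarrow> small S"
  unfolding small_def using inf card_of_finite_ordLess by blast

lemma not_small_Diff:
  assumes "\<not> small (S :: 'a set)" "small T"
  shows "\<not> small (S - T)"
proof
  assume "small (S - T)"
  then have "small (S - T \<union> T)" using small_Un assms(2) by blast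
  then show False using assms(1) small_subset by blast
qed

lemma not_small_Compl: "small (S :: 'a set) \<Longrightarrow> \<not> small (- S)"
  using not_small_Diff[OF not_small_UNIV] by (simp add: Compl_eq_Diff_UNIV)

lemma bij_UNIV_Times_bool: obtains p :: "'a \<times> bool \<Rightarrow> 'a" where "bij p"
proof -
  have "|UNIV :: bool set| \<le>o |UNIV :: 'a set|"
    using card_of_finite_ordLess[OF _ inf, of "UNIV :: bool set"] ordLess_imp_ordLeq by simp
  then have "|(UNIV :: 'a set) \<times> (UNIV :: bool set)| =o |UNIV :: 'a set|"
    using card_of_Times_infinite[OF inf] by blast
  then show thesis using that card_of_ordIso[of "UNIV \<times> UNIV" UNIV] by auto
qed

lemma not_small_split:
  assumes "\<not> small (S :: 'a set)"
  obtains T where "T \<subseteq> S" "\<not> small T" "\<not> small (S - T)"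
proof -
  obtain h :: "'a \<Rightarrow> 'a" where h: "inj h" "range h \<subseteq> S" using inj_into_not_small[OF assms] by blast
  obtain p :: "'a \<times> bool \<Rightarrow> 'a" where p: "bij p" using bij_UNIV_Times_bool by blast
  have pj: "inj p" using p bij_is_inj by blast
  \<comment> \<open>\<open>j True\<close> and \<open>j False\<close> embed two disjoint copies of X
    into \<open>S\<close>.\<close>
  define j :: "bool \<Rightarrow> 'a \<Rightarrow> 'a" where "j b x = h (p (x, b))" for b x
  have j_eq: "j b x = j b' x' \<longleftrightarrow> b = b' \<and> x = x'" for b b' x x'
    unfolding j_def using inj_eq[OF h(1)] inj_eq[OF pj] by auto
  have j: "inj (j b)" for b by (rule injI) (simp add: j_eq)
  have "range (j False) \<subseteq> S - range (j True)"
    using h(2) by (auto simp: j_eq) (auto simp: j_def)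
  then have "\<not> small (S - range (j True))"
    using not_small_range[OF j] small_subset by blast
  moreover have "range (j True) \<subseteq> S" using h(2) unfolding j_def by auto
  ultimately show thesis using that not_small_range[OF j] by blast
qed

end

section \<open>Index cardinals as sizes of subsets of X\<close>

text \<open>Every cardinal of \<open>index_cardinals\<close> is realised by a set of this kind.\<close>

definition index_set :: "'a set \<Rightarrow> bool" where
  "index_set L \<longleftrightarrow> (\<exists>x. L = {x}) \<or> infinite L"

lemma ordIso_ordLeq_iff: "\<nu> =o \<nu>' \<Longrightarrow> \<nu> \<le>o \<mu> \<longleftrightarrow> \<nu>' \<le>o \<mu>"
  using ordIso_ordLeq_trans[of \<nu> \<nu>' \<mu>] ordIso_ordLeq_trans[of \<nu>' \<nu> \<mu>]
    ordIso_symmetric[of \<nu> \<nu>'] by blast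

lemma ordLess_ordIso_iff: "\<nu> =o \<nu>' \<Longrightarrow> \<mu> <o \<nu> \<longleftrightarrow> \<mu> <o \<nu>'"
  using ordLess_ordIso_trans[of \<mu> \<nu> \<nu>'] ordLess_ordIso_trans[of \<mu> \<nu>' \<nu>]
    ordIso_symmetric[of \<nu> \<nu>'] by blast

lemma ordIso_ordIso_iff: "\<nu> =o \<nu>' \<Longrightarrow> \<mu> =o \<nu> \<longleftrightarrow> \<mu> =o \<nu>'"
  using ordIso_transitive[of \<mu> \<nu> \<nu>'] ordIso_transitive[of \<mu> \<nu>' \<nu>]
    ordIso_symmetric[of \<nu> \<nu>'] by blast

lemma monoid_G_cong: "\<nu> =o \<nu>' \<Longrightarrow> monoid_G \<nu> = monoid_G \<nu>'"
  unfolding monoid_G_def by (simp add: ordIso_ordLeq_iff ordIso_ordIso_iff)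

lemma monoid_M_cong: "\<nu> =o \<nu>' \<Longrightarrow> monoid_M \<nu> = monoid_M \<nu>'"
  unfolding monoid_M_def card_injective_def card_surjective_def
  by (simp add: ordLess_ordIso_iff)

lemma ordIso_cone_iff: "|L| =o cone \<longleftrightarrow> (\<exists>x. L = {x})"
proof
  assume "|L| =o cone"
  then obtain f where "bij_betw f L {()}" unfolding cone_def using card_of_ordIso by blast
  then obtain x where "f x = ()" "x \<in> L" unfolding bij_betw_def by auto
  moreover have "y = x" if "y \<in> L" for y
    using \<open>bij_betw f L {()}\<close> that \<open>x \<in> L\<close> by (auto simp: bij_betw_def dest: inj_onD)
  ultimately show "\<exists>x. L = {x}" by blast
next
  assume "\<exists>x. L = {x}"
  then obtain x where "L = {x}" by blast
  then have "bij_betw (\<lambda>_. ()) L {()}" by (simp add: bij_betw_def)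
  then show "|L| =o cone" unfolding cone_def using card_of_ordIso by blast
qed

lemma index_cardinals_iff: "|L| \<in> index_cardinals \<longleftrightarrow> index_set L"
  unfolding index_cardinals_def index_set_def
  using infinite_iff_natLeq_ordLeq[of L]
  by (auto simp add: ordIso_cone_iff card_of_Card_order card_of_mono1)

lemma index_cardinals_cong:
  fixes \<nu> \<nu>' :: "'a rel"
  shows "\<nu> =o \<nu>' \<Longrightarrow> Card_order \<nu>' \<Longrightarrow> \<nu> \<in> index_cardinals \<Longrightarrow> \<nu>' \<in> index_cardinals"
  unfolding index_cardinals_def mem_Collect_eq
  using ordIso_ordLeq_iff[of \<nu> \<nu>' "|UNIV :: 'a set|"] ordLeq_ordIso_trans[of natLeq \<nu> \<nu>']
    ordIso_transitive[of \<nu>' \<nu> cone] ordIso_symmetric[of \<nu> \<nu>'] by blast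

text \<open>A cardinal order is isomorphic to the cardinality of its field, so families indexed by
  relations become families indexed by subsets of X.\<close>

lemma index_family_eq:
  assumes "\<And>\<nu> \<nu>'. \<nu> =o \<nu>' \<Longrightarrow> F \<nu> = F \<nu>'"
  shows "{F \<nu> | \<nu>. \<nu> \<in> index_cardinals} = {F |L| | L. index_set L}"
proof (intro Set.set_eqI iffI)
  fix M assume "M \<in> {F \<nu> | \<nu>. \<nu> \<in> index_cardinals}"
  then obtain \<nu> where \<nu>: "\<nu> \<in> index_cardinals" "M = F \<nu>" by blast
  then have "\<nu> =o |Field \<nu>|"
    unfolding index_cardinals_def using card_of_Field_ordIso ordIso_symmetric by blast
  then have "|Field \<nu>| \<in> index_cardinals" "M = F |Field \<nu>|"
    using \<nu> assms index_cardinals_cong card_of_Card_order by blast+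
  then show "M \<in> {F |L| | L. index_set L}" by (auto simp: index_cardinals_iff)
qed (auto simp: index_cardinals_iff[symmetric])

lemma not_in_monoid_G:
  "f \<notin> monoid_G |L| \<longleftrightarrow> (\<exists>C. |C| =o |L| \<and> |- f ` (- C)| <o |L| )"
  unfolding monoid_G_def by (simp add: Compl_eq_Diff_UNIV ordLeq_iff_not_ordLess[symmetric])

lemma not_in_monoid_M:
  "f \<notin> monoid_M |L| \<longleftrightarrow> (\<exists>C. |C| <o |L| \<and> inj_on f (- C)) \<and> |L| \<le>o |- range f|"
  unfolding monoid_M_def card_surjective_def card_injective_def
  by (auto simp: Compl_eq_Diff_UNIV ordLeq_iff_not_ordLess[symmetric])

text \<open>For index 1 the exceptional sets are empty: a map outside M_1 is injective but not onto,
  and a map outside G_1 stays onto after some point is deleted.\<close>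

lemma ordLess_singleton_iff: "|A| <o |{x}| \<longleftrightarrow> A = {}"
proof
  assume "|A| <o |{x}|"
  show "A = {}"
  proof (rule ccontr)
    assume "A \<noteq> {}"
    then have "|{x}| \<le>o |A|" by (rule card_of_singl_ordLeq)
    then show False using \<open>|A| <o |{x}|\<close> not_ordLess_ordLeq by blast
  qed
next
  assume "A = {}"
  then show "|A| <o |{x}|" using card_of_ordLess[of "{x}" A] by simp
qed

lemma empty_ordLess: "L \<noteq> {} \<Longrightarrow> |{} :: 'a set| <o |L :: 'a set|"
  using card_of_ordLess[of L "{} :: 'a set"] by simp

lemma index_set_nonempty: "index_set L \<Longrightarrow> L \<noteq> {}"
  unfolding index_set_def by auto

section \<open>Monoids that contain all permutations and lie in no listed monoid\<close>

locale perm_monoid =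
  fixes G :: "('a \<Rightarrow> 'a) set"
  assumes inf: "infinite (UNIV :: 'a set)"
    and comp_closed: "f \<in> G \<Longrightarrow> g \<in> G \<Longrightarrow> f \<circ> g \<in> G"
    and bij_mem: "bij \<pi> \<Longrightarrow> \<pi> \<in> G"
begin

text \<open>Finite \<open>A\<close> is treated point by point with M_1, since no index cardinal lies
  strictly between 1 and aleph_0; infinite \<open>A\<close> uses M_|A| and the hypothesis for an
  exceptional set of smaller size.\<close>

lemma ex_inj_avoiding:
  assumes M: "\<And>L :: 'a set. index_set L \<Longrightarrow> \<not> G \<subseteq> monoid_M |L|"
  shows "\<not> small (- A) \<Longrightarrow> \<exists>g\<in>G. inj g \<and> range g \<subseteq> - A"
proof (induction A rule: wf_induct[OF wf_inv_image[OF wf_ordLess, of card_of]])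
  case (1 A)
  show ?case
  proof (cases "finite A")
    case True
    then show ?thesis
    proof (induction A)
      case empty
      show ?case by (rule bexI[OF _ bij_mem[of id]]) auto
    next
      case (insert a B)
      obtain g where g: "g \<in> G" "inj g" "range g \<subseteq> - B" using insert.IH by blast
      show ?case
      proof (cases "a \<in> range g")
        case False
        then show ?thesis using g by auto
      next
        case True
        then obtain b where b: "g b = a" by blast
        have "\<exists>f\<in>G. f \<notin> monoid_M |{a}|"
          using M[of "{a}"] unfolding index_set_def by blast
        then obtain f C where f: "f \<in> G" "|C| <o |{a}|" "inj_on f (- C)" "|{a}| \<le>o |- range f|"
              unfolding not_in_monoid_M by blast
        have "- range f \<noteq> {}" using f(4) card_of_empty3[of "{a}"] by auto
        then obtain p where p: "p \<notin> range f" by blast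
        have "C = {}" using f(2) by (simp add: ordLess_singleton_iff)
        then have injf: "inj f" using f(3) by simp
        \<comment> \<open>\<open>f\<close> misses \<open>p\<close>, so \<open>t \<circ> f\<close>
          misses \<open>b\<close>, the only point that \<open>g\<close> sends to
          \<open>a\<close>.\<close>
        define t where "t = transpose p b"
        have t: "bij t" "t p = b" unfolding t_def by simp_all
        let ?h = "g \<circ> (t \<circ> f)"
        have "t (f x) \<noteq> b" for x
          using p t bij_is_inj[OF t(1)] by (metis injD rangeI)
        then have "g (t (f x)) \<noteq> a" for x
          using b g(2) by (metis injD)
        moreover have "g (t (f x)) \<notin> B" for x using g(3) by auto
        ultimately have "range ?h \<subseteq> - insert a B" by auto
        moreover have "inj ?h" using injf bij_is_inj[OF t(1)] g(2) by (intro inj_compose)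
        moreover have "?h \<in> G" using g(1) f(1) t(1) comp_closed bij_mem by blast
        ultimately show ?thesis by blast
      qed
    qed
  next
    case False
    then have "\<exists>f\<in>G. f \<notin> monoid_M |A|"
           using M[of A] False unfolding index_set_def by blast
         then obtain f C where f: "f \<in> G" "|C| <o |A|" "inj_on f (- C)" "|A| \<le>o |- range f|"
           unfolding not_in_monoid_M by blast
    have "\<not> small (- C)" using not_small_Compl[OF inf small_ordLess[OF f(2)]] .
    then obtain g where g: "g \<in> G" "inj g" "range g \<subseteq> - C"
      using 1(1) f(2) by auto
    \<comment> \<open>A set \<open>D\<close> of the exact size of \<open>A\<close> among the omitted
      points; a permutation taking \<open>D\<close> to \<open>A\<close> makes \<open>A\<close> the
      omitted set.\<close>
    obtain D where D: "D \<subseteq> - range f" "|D| =o |A|" using ordLeq_subset[OF f(4)] by blast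
    have inj: "inj (f \<circ> g)" using g(2,3) f(3) by (meson comp_inj_on inj_on_subset)
    have "range (f \<circ> g) \<subseteq> - D" using D(1) by auto
    then have "\<not> small (- D)" using not_small_range[OF inj] small_subset by blast
    then obtain \<delta> where \<delta>: "bij \<delta>" "\<delta> ` D = A" using bij_carrying[OF D(2)] 1(2) by blast
    have "range (\<delta> \<circ> (f \<circ> g)) \<subseteq> \<delta> ` (- D)" using D(1) by auto
    also have "\<dots> = - A" using \<delta> bij_image_Compl_eq by blast
    finally have "range (\<delta> \<circ> (f \<circ> g)) \<subseteq> - A" .
    moreover have "inj (\<delta> \<circ> (f \<circ> g))" by (rule inj_compose[OF bij_is_inj[OF \<delta>(1)] inj])
    moreover have "\<delta> \<circ> (f \<circ> g) \<in> G" using g(1) f(1) \<delta>(1) comp_closed bij_mem by blast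
    ultimately show ?thesis by blast
  qed
qed

lemma ex_surj_omitting:
  assumes M: "\<And>L :: 'a set. index_set L \<Longrightarrow> \<not> G \<subseteq> monoid_G |L|"
  shows "\<not> small (- A) \<Longrightarrow> \<exists>g\<in>G. g ` (- A) = UNIV"
proof (induction A rule: wf_induct[OF wf_inv_image[OF wf_ordLess, of card_of]])
  case (1 A)
  show ?case
  proof (cases "finite A")
    case True
    then show ?thesis
    proof (induction A)
      case empty
      show ?case by (rule bexI[OF _ bij_mem[of id]]) auto
    next
      case (insert a B)
      obtain g where g: "g \<in> G" "g ` (- B) = UNIV" using insert.IH by blast
      have "\<exists>f\<in>G. f \<notin> monoid_G |{a}|"
        using M[of "{a}"] unfolding index_set_def by blast
      then obtain f C where f: "f \<in> G" "|C| =o |{a}|" "|- f ` (- C)| <o |{a}|"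
          unfolding not_in_monoid_G by blast
      have "|C| =o cone"
        using f(2) ordIso_cone_iff[of "{a}"] ordIso_transitive by blast
      then obtain p where p: "C = {p}" unfolding ordIso_cone_iff by blast
      have fC: "f ` (- {p}) = UNIV" using f(3) p by (auto simp: ordLess_singleton_iff)
      \<comment> \<open>After \<open>g\<close> and \<open>t\<close> the point \<open>a\<close>
        arrives at \<open>p\<close>, which \<open>f\<close> can spare.\<close>
      define t where "t = transpose (g a) p"
      have t: "bij t" "t (g a) = p" unfolding t_def by simp_all
      have "z \<in> (f \<circ> (t \<circ> g)) ` (- insert a B)" for z
      proof -
        obtain y where y: "y \<noteq> p" "f y = z" using fC by (metis ComplD UNIV_I imageE singletonI)
        obtain y' where y': "t y' = y" using t(1) by (metis bij_pointE)
        obtain x where x: "x \<notin> B" "g x = y'" using g(2) by (metis ComplD UNIV_I imageE)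
        have "x \<noteq> a" using t(2) y' x y by auto
        then show ?thesis using x y y' by force
      qed
      then have "(f \<circ> (t \<circ> g)) ` (- insert a B) = UNIV" by blast
      moreover have "f \<circ> (t \<circ> g) \<in> G" using g(1) f(1) t(1) comp_closed bij_mem by blast
      ultimately show ?case by blast
    qed
  next
    case False
    then have "\<exists>f\<in>G. f \<notin> monoid_G |A|"
           using M[of A] False unfolding index_set_def by blast
         then obtain f C where f: "f \<in> G" "|C| =o |A|" "|- f ` (- C)| <o |A|"
           unfolding not_in_monoid_G by blast
    \<comment> \<open>\<open>?D\<close> is what \<open>f\<close> misses once \<open>C\<close> is
      deleted. It is smaller than \<open>A\<close>, so the induction hypothesis gives a
      \<open>g\<close> that is onto without it; then \<open>g \<circ> f\<close> is onto without
      \<open>C\<close>, and \<open>\<delta>\<close> turns \<open>C\<close> into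
      \<open>A\<close>.\<close>
    let ?D = "- f ` (- C)"
    have "\<not> small (- ?D)" using not_small_Compl[OF inf small_ordLess[OF f(3)]] .
    then obtain g where g: "g \<in> G" "g ` (- ?D) = UNIV"
      using 1(1) f(3) by auto
    have "g ` f ` (- C) = UNIV" using g(2) by simp
    then have onto: "(g \<circ> f) ` (- C) = UNIV" by (simp add: image_comp)
    then have "\<not> small (- C)" using not_small_UNIV small_image by metis
    then obtain \<delta> where \<delta>: "bij \<delta>" "\<delta> ` A = C"
      using bij_carrying[OF ordIso_symmetric[OF f(2)]] 1(2) by blast
    then have "\<delta> ` (- A) = - C" using bij_image_Compl_eq by blast
    then have "((g \<circ> f) \<circ> \<delta>) ` (- A) = UNIV" using onto by (simp only: image_comp[symmetric])
    moreover have "(g \<circ> f) \<circ> \<delta> \<in> G" using g(1) f(1) \<delta>(1) comp_closed bij_mem by blast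
    ultimately show ?thesis by blast
  qed
qed

lemma eq_UNIV_if_not_subset:
  assumes M: "\<And>L :: 'a set. index_set L \<Longrightarrow> \<not> G \<subseteq> monoid_M |L|"
    and Gm: "\<And>L :: 'a set. index_set L \<Longrightarrow> \<not> G \<subseteq> monoid_G |L|"
    and h: "h \<in> G" "\<not> small {y. \<not> small (h -` {y})}"
  shows "G = UNIV"
proof -
  obtain A :: "'a set" where A: "\<not> small A" "\<not> small (- A)"
    using not_small_split[OF inf not_small_UNIV] by (metis Compl_eq_Diff_UNIV)
  obtain i where i: "i \<in> G" "inj i" "range i \<subseteq> - A"
    using ex_inj_avoiding[OF M A(2)] by blast
  have coi: "\<not> small (- range i)" using i(3) A(1) small_subset by blast
  obtain s0 where s0: "s0 \<in> G" "s0 ` (- A) = UNIV"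
    using ex_surj_omitting[OF Gm A(2)] by blast
  \<comment> \<open>Only half of the points with large fibre are used, so that the complement of
    \<open>B\<close> is large and \<open>\<gamma>\<close> exists.\<close>
  obtain B where B: "B \<subseteq> {y. \<not> small (h -` {y})}" "\<not> small B"
    "\<not> small ({y. \<not> small (h -` {y})} - B)"
    using not_small_split[OF inf h(2)] by blast
  have "\<not> small (- B)" using B(3) small_subset by (metis Compl_eq_Diff_UNIV Diff_mono order_refl subset_UNIV)
  then obtain \<gamma> where \<gamma>: "bij \<gamma>" "\<gamma> ` B = - A"
    using bij_carrying[of B "- A"] not_small_ordIso_both B(2) A by (metis double_compl)
  \<comment> \<open>\<open>s0\<close> maps \<open>- A\<close> onto X, and \<open>\<gamma>\<close>
    places points with large \<open>h\<close>-fibre exactly on \<open>- A\<close>; hence every fibre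
    of \<open>s\<close> is large.\<close>
  define s where "s = s0 \<circ> (\<gamma> \<circ> h)"
  have sG: "s \<in> G" unfolding s_def using s0(1) \<gamma>(1) h(1) comp_closed bij_mem by blast
  have s: "\<not> small (s -` {y})" for y
  proof -
    obtain z where z: "z \<in> - A" "s0 z = y" using s0(2) by (metis UNIV_I imageE)
    then obtain b where b: "b \<in> B" "\<gamma> b = z" using \<gamma>(2) by (metis imageE)
    have "h -` {b} \<subseteq> s -` {y}" using b z unfolding s_def by auto
    then show ?thesis using b(1) B(1) small_subset by blast
  qed
  then have "\<exists>H :: 'a \<Rightarrow> 'a. inj H \<and> range H \<subseteq> s -` {y}" for y
    using inj_into_not_small by metis
  then obtain H :: "'a \<Rightarrow> 'a \<Rightarrow> 'a" where H: "\<And>y. inj (H y)" "\<And>y. range (H y) \<subseteq> s -` {y}"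
    by metis
  have sH: "s (H y z) = y" for y z using H(2)[of y] by auto
  have H_eq: "H y z = H y' z' \<longleftrightarrow> y = y' \<and> z = z'" for y y' z z'
    using sH H(1) by (metis injD)
  have "f \<in> G" for f
  proof -
    \<comment> \<open>\<open>e x\<close> is the point with index \<open>i x\<close> in the fibre of
      \<open>s\<close> over \<open>f x\<close>, so \<open>s \<circ> e = f\<close>. Using
      \<open>i x\<close> as index makes \<open>e\<close> injective, and the indices outside
      \<open>range i\<close> leave a large set outside its range.\<close>
    define e where "e x = H (f x) (i x)" for x
    have e: "inj e" unfolding e_def inj_def H_eq using i(2) by (auto dest: injD)
    have "H y ` (- range i) \<subseteq> - range e" for y unfolding e_def by (auto simp: H_eq)
    then have coe: "\<not> small (- range e)"
      using not_small_inj_image[OF coi, of "H y" for y] H(1) inj_on_subset small_subset subset_UNIV by metis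
    have "bij_betw (e \<circ> inv_into UNIV i) (range i) (range e)"
      by (rule bij_betwI[where g = "i \<circ> inv_into UNIV e"]) (auto simp: i(2) e)
    then obtain \<pi> where \<pi>: "bij \<pi>" "\<And>x. x \<in> range i \<Longrightarrow> \<pi> x = (e \<circ> inv_into UNIV i) x"
      using bij_extend[OF _ coi coe] by blast
    have "f = s \<circ> (\<pi> \<circ> i)" by (rule ext) (simp add: \<pi>(2) i(2) e_def sH)
    then show ?thesis using sG i(1) \<pi>(1) comp_closed bij_mem by metis
  qed
  then show ?thesis by blast
qed

lemma eq_UNIV_if_regular:
  assumes M: "\<And>L :: 'a set. index_set L \<Longrightarrow> \<not> G \<subseteq> monoid_M |L|"
    and Gm: "\<And>L :: 'a set. index_set L \<Longrightarrow> \<not> G \<subseteq> monoid_G |L|"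
    and A: "\<not> G \<subseteq> monoid_A"
  shows "G = UNIV"
proof -
  obtain h where h: "h \<in> G" "h \<notin> monoid_A" using A by blast
  have "UNIV - {y. small (h -` {y})} = {y. \<not> small (h -` {y})}" by blast
  then have "\<not> small {y. \<not> small (h -` {y})}"
    using h(2) unfolding monoid_A_def almost_all_def co_small_def mem_Collect_eq by (metis mem_Collect_eq)
  then show ?thesis using eq_UNIV_if_not_subset[OF M Gm h(1)] by blast
qed

end

section \<open>The singular case: adding up smaller fibres\<close>

text \<open>Recursion along a well-order of X of type |X|: at each stage only a small set of values
  is taken, which cannot exhaust \<open>B x\<close>.\<close>

lemma inj_choice:
  fixes B :: "'a \<Rightarrow> 'a set"
  assumes "\<And>x. \<not> small (B x)"
  obtains b where "inj b" "\<And>x. b x \<in> B x"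
proof -
  let ?r = "|UNIV :: 'a set|"
  have wo: "Well_order ?r" by (rule card_of_Well_order)
  have Fr: "Field ?r = UNIV" by (rule Field_card_of)
  have "\<exists>b. \<forall>x. b x \<in> B x \<and> b x \<notin> b ` underS ?r x"
  proof (rule dependent_wf_choice[where R = "?r - Id"])
    show "wf (?r - Id)" using wo unfolding well_order_on_def by blast
  next
    fix f g :: "'a \<Rightarrow> 'a" and x r
    assume "\<And>z. (z, x) \<in> ?r - Id \<Longrightarrow> f z = g z"
    then have "f ` underS ?r x = g ` underS ?r x" unfolding underS_def by (intro image_cong) auto
    then show "(r \<in> B x \<and> r \<notin> f ` underS ?r x) = (r \<in> B x \<and> r \<notin> g ` underS ?r x)" by simp
  next
    fix x and f :: "'a \<Rightarrow> 'a"
    have "small (underS ?r x)"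
      unfolding small_def by (rule card_of_underS) (simp_all add: Fr card_of_Card_order card_of_card_order_on)
    then have "\<not> B x \<subseteq> f ` underS ?r x" using assms small_image small_subset by blast
    then show "\<exists>r. r \<in> B x \<and> r \<notin> f ` underS ?r x" by blast
  qed
  then obtain b where b: "\<And>x. b x \<in> B x" "\<And>x. b x \<notin> b ` underS ?r x" by blast
  have "inj b"
  proof (rule injI, rule ccontr)
    fix x y assume "b x = b y" "x \<noteq> y"
    moreover have "(x, y) \<in> ?r \<or> (y, x) \<in> ?r"
      using wo \<open>x \<noteq> y\<close> Fr unfolding well_order_on_def linear_order_on_def total_on_def by blast
    ultimately have "x \<in> underS ?r y \<or> y \<in> underS ?r x" unfolding underS_def by auto
    then show False using b(2) \<open>b x = b y\<close> by (metis imageI)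
  qed
  then show thesis using that b(1) by blast
qed

context perm_monoid
begin

lemma eq_UNIV_if_singular:
  assumes sing: "\<not> regularCard |UNIV :: 'a set|"
    and M: "\<And>L :: 'a set. index_set L \<Longrightarrow> \<not> G \<subseteq> monoid_M |L|"
    and Gm: "\<And>L :: 'a set. index_set L \<Longrightarrow> \<not> G \<subseteq> monoid_G |L|"
    and A: "\<not> G \<subseteq> monoid_A'"
  shows "G = UNIV"
proof -
  let ?r = "|UNIV :: 'a set|"
  obtain f where f: "f \<in> G" "f \<notin> monoid_A'" using A by blast
  \<comment> \<open>That \<open>f\<close> is outside \<open>monoid_A'\<close> means that no small
    \<open>T\<close> bounds almost all fibres, so \<open>B T\<close> is large for every small
    \<open>T\<close>.\<close>
  define B where "B T = {y. |T| \<le>o |f -` {y}|}" for T :: "'a set"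
  have B: "\<not> small (B T)" if "small T" for T
  proof
    assume "small (B T)"
    then have "co_small (- B T)" unfolding co_small_def by (simp add: Compl_eq_Diff_UNIV[symmetric])
    moreover have "|f -` {y}| \<le>o |T|" if "y \<in> - B T" for y
      using that ordLeq_iff_not_ordLess ordLess_imp_ordLeq unfolding B_def by blast
    ultimately have "almost_all (\<lambda>y. |f -` {y}| \<le>o |T| )" unfolding almost_all_def by blast
    then show False
      using f(2) \<open>small T\<close> card_of_Card_order unfolding monoid_A'_def small_def by blast
  qed
  obtain K where K: "cofinal K ?r" "\<not> |K| =o ?r"
    using sing unfolding regularCard_def by blast
  have smallK: "small K" using K(2) not_small_ordIso by blast
  have uK: "small (underS ?r k)" for k
    unfolding small_def by (rule card_of_underS) (simp_all add: Field_card_of card_of_Card_order card_of_card_order_on)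
  have "\<exists>k\<in>K. x \<in> underS ?r k" for x
    using K(1) unfolding cofinal_def underS_def by (auto simp: Field_card_of)
  then obtain k where k: "\<And>x. k x \<in> K" "\<And>x. x \<in> underS ?r (k x)" by metis
  obtain p :: "'a \<times> bool \<Rightarrow> 'a" where p: "bij p" using bij_UNIV_Times_bool[OF inf] by blast
  define q where "q = inv_into UNIV p"
  have q: "bij q" unfolding q_def using p by (rule bij_imp_bij_inv)
  text \<open>Each \<open>y \<in> B K\<close> has a preimage \<open>c y l\<close> for every \<open>l \<in> K\<close>. A permutation \<open>\<gamma>\<close> moves onto
    \<open>c y l\<close> a point whose fibre under \<open>f\<close> has at least the size of \<open>underS l\<close>; the fibre of
    \<open>f \<circ> \<gamma> \<circ> f\<close> over \<open>y\<close> is then as large as the union of these initial segments, which is \<open>X\<close>.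
    Using only half \<open>Y\<close> of \<open>B K\<close>, and choosing the points in pairs, leaves room for extending \<open>\<gamma>\<close>.\<close>
  have "\<exists>c. inj_on c K \<and> c ` K \<subseteq> f -` {y}" if "y \<in> B K" for y
    using that unfolding B_def by (simp add: card_of_ordLeq)
  then obtain c where c: "\<And>y. y \<in> B K \<Longrightarrow> inj_on (c y) K" "\<And>y. y \<in> B K \<Longrightarrow> c y ` K \<subseteq> f -` {y}"
    by metis
  have fc: "f (c y l) = y" if "y \<in> B K" "l \<in> K" for y l using c(2)[OF that(1)] that(2) by auto
  \<comment> \<open>\<open>inj_choice\<close> is indexed by all of X, so the index \<open>l\<close>
    must be readable from the point \<open>c y l\<close> alone. Elsewhere the value is arbitrary,
    which is harmless because every \<open>underS\<close> is small.\<close>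
  define lab where "lab x = (SOME l. l \<in> K \<and> c (f x) l = x)" for x
  have lab: "lab (c y l) = l" if "y \<in> B K" "l \<in> K" for y l
  proof -
    have "\<exists>l'. l' \<in> K \<and> c (f (c y l)) l' = c y l" using that fc by auto
    then have "lab (c y l) \<in> K \<and> c (f (c y l)) (lab (c y l)) = c y l"
      unfolding lab_def by (rule someI_ex)
    then show ?thesis using that fc c(1) by (metis inj_onD)
  qed
  \<comment> \<open>Each \<open>x\<close> receives two values, \<open>b (p (x, True))\<close> and
    \<open>b (p (x, False))\<close>. Those with \<open>True\<close> will form \<open>Q\<close>;
    those with \<open>False\<close> keep the complement of \<open>Q\<close> large.\<close>
  obtain b where b: "inj b" "\<And>z. b z \<in> B (underS ?r (lab (fst (q z))))"
    using inj_choice[of "\<lambda>z. B (underS ?r (lab (fst (q z))))"] B uK by blast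
  have qp: "q (p z) = z" for z unfolding q_def using p by (simp add: bij_is_inj)
  have bp_eq: "b (p z) = b (p z') \<longleftrightarrow> z = z'" for z z' using b(1) qp by (metis injD)
  obtain Y where Y: "Y \<subseteq> B K" "\<not> small Y" "\<not> small (B K - Y)"
    using not_small_split[OF inf B[OF smallK]] by blast
  define P where "P = {c y l | y l. y \<in> Y \<and> l \<in> K}"
  have "inj_on (\<lambda>y. c y (k undefined)) (B K - Y)"
    using fc k(1) by (intro inj_onI) (metis DiffD1)
  then have "\<not> small ((\<lambda>y. c y (k undefined)) ` (B K - Y))" using Y(3) not_small_inj_image by blast
  moreover have "(\<lambda>y. c y (k undefined)) ` (B K - Y) \<subseteq> - P"
  proof (intro image_subsetI ComplI)
    fix y assume y: "y \<in> B K - Y" "c y (k undefined) \<in> P"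
    then obtain y' l where "y' \<in> Y" "l \<in> K" "c y (k undefined) = c y' l" unfolding P_def by blast
    then have "y = y'" using fc k(1) y(1) Y(1) by (metis DiffD1 subsetD)
    then show False using y(1) \<open>y' \<in> Y\<close> by blast
  qed
  ultimately have coP: "\<not> small (- P)" using small_subset by blast
  define Q where "Q = (\<lambda>x. b (p (x, True))) ` P"
  have "inj (\<lambda>x. b (p (x, False)))" by (rule injI) (simp add: bp_eq)
  then have "\<not> small (range (\<lambda>x. b (p (x, False))))" by (rule not_small_range)
  moreover have "range (\<lambda>x. b (p (x, False))) \<subseteq> - Q" unfolding Q_def by (auto simp: bp_eq)
  ultimately have coQ: "\<not> small (- Q)" using small_subset by blast
  have "bij_betw (\<lambda>z. fst (q (inv_into UNIV b z))) Q P"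
    unfolding Q_def by (rule bij_betwI[where g = "\<lambda>x. b (p (x, True))"]) (auto simp: b(1) qp)
  then obtain \<gamma> where \<gamma>: "bij \<gamma>" "\<And>z. z \<in> Q \<Longrightarrow> \<gamma> z = fst (q (inv_into UNIV b z))"
    using bij_extend[OF _ coQ coP] by blast
  have \<gamma>': "\<gamma> (b (p (x, True))) = x" if "x \<in> P" for x
    using that \<gamma>(2)[of "b (p (x, True))"] unfolding Q_def by (simp add: b(1) qp)
  define h where "h = f \<circ> (\<gamma> \<circ> f)"
  have hG: "h \<in> G" unfolding h_def using f(1) \<gamma>(1) comp_closed bij_mem by blast
  have "\<not> small (h -` {y})" if y: "y \<in> Y" for y
  proof -
    have yB: "y \<in> B K" using y Y(1) by blast
    define d where "d l = b (p (c y l, True))" for l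
    have "\<exists>J. inj_on J (underS ?r l) \<and> J ` underS ?r l \<subseteq> f -` {d l}" if "l \<in> K" for l
    proof -
      have "d l \<in> B (underS ?r l)"
        using b(2)[of "p (c y l, True)"] unfolding d_def by (simp add: qp lab yB that)
      then show ?thesis unfolding B_def by (simp add: card_of_ordLeq)
    qed
    then obtain J where J: "\<And>l. l \<in> K \<Longrightarrow> inj_on (J l) (underS ?r l)"
      "\<And>l. l \<in> K \<Longrightarrow> J l ` underS ?r l \<subseteq> f -` {d l}" by metis
    have fJ: "f (J (k x) x) = d (k x)" for x using J(2)[OF k(1)] k(2) by fastforce
    \<comment> \<open>\<open>x \<mapsto> J (k x) x\<close> embeds X into the fibre of
      \<open>h\<close> over \<open>y\<close>: \<open>f\<close> leads to \<open>d (k x)\<close>,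
      \<open>\<gamma>\<close> to \<open>c y (k x)\<close>, and \<open>f\<close> to
      \<open>y\<close>.\<close>
    have J_inj: "inj (\<lambda>x. J (k x) x)"
    proof (rule injI)
      fix x x' assume eq: "J (k x) x = J (k x') x'"
      then have "d (k x) = d (k x')" using fJ by metis
      then have "c y (k x) = c y (k x')" unfolding d_def by (simp add: bp_eq)
      then have "k x = k x'" using c(1)[OF yB] k(1) by (metis inj_onD)
      then show "x = x'" using eq J(1)[OF k(1)] k(2) by (metis inj_onD)
    qed
    have "h (J (k x) x) = y" for x
    proof -
      have "c y (k x) \<in> P" unfolding P_def using y k(1) by blast
      then show ?thesis unfolding h_def by (simp add: fJ d_def \<gamma>' fc yB k(1))
    qed
    then have "range (\<lambda>x. J (k x) x) \<subseteq> h -` {y}" by auto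
    then show ?thesis using not_small_range[OF J_inj] small_subset by blast
  qed
  then have "Y \<subseteq> {y. \<not> small (h -` {y})}" by blast
  then have "\<not> small {y. \<not> small (h -` {y})}" using Y(2) small_subset by blast
  then show ?thesis using eq_UNIV_if_not_subset[OF M Gm hG] by blast
qed

end

section \<open>Symmetric precomplete monoids contain all permutations\<close>

lemma not_small_ex_inj_range:
  fixes S :: "'a set"
  assumes "\<not> small S"
  obtains j :: "'a \<Rightarrow> 'a" where "inj j" "range j = S"
proof -
  obtain j :: "'a \<Rightarrow> 'a" where "bij_betw j UNIV S"
    using not_small_ordIso_both[OF not_small_UNIV assms] card_of_ordIso by blast
  then show thesis using that[of j] by (simp add: bij_betw_def)
qed

text \<open>Conjugates of an injection with large co-range realise every prescribed bijection between
  two disjoint large sets, as it already acts in this way on the complement of its range.\<close>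

lemma ex_conj_extending:
  fixes i \<phi> :: "'a \<Rightarrow> 'a"
  assumes i: "inj i" "\<not> small (- range i)"
    and \<phi>: "bij_betw \<phi> Y Z" and YZ: "Y \<inter> Z = {}" "\<not> small Y" "\<not> small (- (Y \<union> Z))"
  obtains \<epsilon> where "bij \<epsilon>" "\<And>y. y \<in> Y \<Longrightarrow> (inv_into UNIV \<epsilon> \<circ> i \<circ> \<epsilon>) y = \<phi> y"
proof -
  let ?Y0 = "- range i"
  obtain \<beta> where \<beta>: "bij_betw \<beta> Y ?Y0"
    using not_small_ordIso_both[OF YZ(2) i(2)] card_of_ordIso by blast
  have \<psi>: "bij_betw (inv_into Y \<phi>) Z Y" using \<phi> by (rule bij_betw_inv_into)
  have i_bij: "bij_betw i ?Y0 (i ` ?Y0)" using i(1) by (auto simp: bij_betw_def inj_on_def)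
  \<comment> \<open>\<open>\<epsilon>\<close> sends \<open>Y\<close> to \<open>- range i\<close> and
    \<open>Z\<close> to the \<open>i\<close>-image of that set, arranged so that
    \<open>i \<circ> \<epsilon> = \<epsilon> \<circ> \<phi>\<close> on \<open>Y\<close>.\<close>
  let ?e = "\<lambda>x. if x \<in> Y then \<beta> x else (i \<circ> (\<beta> \<circ> inv_into Y \<phi>)) x"
  have 1: "bij_betw ?e Y ?Y0"
    using \<beta> by (simp cong: bij_betw_cong)
  have "bij_betw (i \<circ> (\<beta> \<circ> inv_into Y \<phi>)) Z (i ` ?Y0)"
    using bij_betw_trans[OF bij_betw_trans[OF \<psi> \<beta>] i_bij] .
  then have 2: "bij_betw ?e Z (i ` ?Y0)"
    by (rule bij_betw_cong[THEN iffD1, rotated]) (use YZ(1) in auto)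
  have "bij_betw ?e (Y \<union> Z) (?Y0 \<union> i ` ?Y0)"
    using 1 2 by (rule bij_betw_combine) auto
  moreover have "\<not> small (- (?Y0 \<union> i ` ?Y0))"
  proof -
    \<comment> \<open>The second iterate of \<open>i\<close> on the complement of its range is the
      free space.\<close>
    have "i ` i ` ?Y0 \<subseteq> - (?Y0 \<union> i ` ?Y0)" using i(1) by (auto dest: injD)
    moreover have "\<not> small (i ` i ` ?Y0)"
      using i not_small_inj_image inj_on_subset subset_UNIV by metis
    ultimately show ?thesis using small_subset by blast
  qed
  ultimately obtain \<epsilon> where \<epsilon>: "bij \<epsilon>" "\<And>x. x \<in> Y \<union> Z \<Longrightarrow> \<epsilon> x = ?e x"
    using bij_extend YZ(3) by blast
  have "(inv_into UNIV \<epsilon> \<circ> i \<circ> \<epsilon>) y = \<phi> y" if y: "y \<in> Y" for y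
  proof -
    have "\<phi> y \<in> Z" using \<phi> y bij_betwE by blast
    then have "\<epsilon> (\<phi> y) = i (\<beta> (inv_into Y \<phi> (\<phi> y)))" using \<epsilon>(2) YZ(1) by auto
    also have "inv_into Y \<phi> (\<phi> y) = y" using \<phi> y by (simp add: bij_betw_def)
    also have "i (\<beta> y) = i (\<epsilon> y)" using \<epsilon>(2) y by simp
    finally have "i (\<epsilon> y) = \<epsilon> (\<phi> y)" by simp
    then show ?thesis using \<epsilon>(1) by (simp add: bij_is_inj)
  qed
  then show thesis using that \<epsilon>(1) by blast
qed

lemma submonoid_full_trans_monoid_iff:
  fixes G :: "('a \<Rightarrow> 'a) set"
  shows "submonoid G full_trans_monoid \<longleftrightarrow> id \<in> G \<and> (\<forall>f\<in>G. \<forall>g\<in>G. f \<circ> g \<in> G)"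
  by (auto simp: submonoid_def full_trans_monoid_def)

lemma precomplete_iff:
  fixes G :: "('a \<Rightarrow> 'a) set"
  shows "precomplete G \<longleftrightarrow> submonoid G full_trans_monoid \<and> G \<noteq> UNIV \<and>
    (\<forall>H. submonoid H full_trans_monoid \<and> G \<subset> H \<longrightarrow> H = UNIV)"
proof -
  have "carrier (full_trans_monoid :: ('a \<Rightarrow> 'a) monoid) = UNIV"
    by (simp add: full_trans_monoid_def)
  moreover have "S \<subset> UNIV \<longleftrightarrow> S \<noteq> UNIV" for S :: "('a \<Rightarrow> 'a) set" by auto
  ultimately show ?thesis unfolding precomplete_def by (simp only: not_ex) blast
qed

lemma precomplete_maximal:
  assumes "precomplete G" "id \<in> H" "\<And>f g :: 'a \<Rightarrow> 'a. f \<in> H \<Longrightarrow> g \<in> H \<Longrightarrow> f \<circ> g \<in> H" "G \<subset> H"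
  shows "H = UNIV"
proof -
  have "submonoid H full_trans_monoid"
    unfolding submonoid_full_trans_monoid_iff using assms(2,3) by blast
  then show ?thesis using assms(1,4) unfolding precomplete_iff by blast
qed

lemma symmetric_conj:
  "symmetric G \<Longrightarrow> f \<in> G \<Longrightarrow> bij \<gamma> \<Longrightarrow> inv_into UNIV \<gamma> \<circ> f \<circ> \<gamma> \<in> G"
  unfolding symmetric_def by blast

lemma symmetric_if_bij_mem:
  fixes G :: "('a \<Rightarrow> 'a) set"
  assumes "\<And>f g :: 'a \<Rightarrow> 'a. f \<in> G \<Longrightarrow> g \<in> G \<Longrightarrow> f \<circ> g \<in> G" "\<And>\<pi>. bij \<pi> \<Longrightarrow> \<pi> \<in> G"
  shows "symmetric G"
  unfolding symmetric_def
proof (intro equalityI subsetI)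
  fix f assume "f \<in> G"
  then have "f = inv_into UNIV id \<circ> f \<circ> id \<and> f \<in> G \<and> bij id" by simp
  then show "f \<in> {inv_into UNIV \<gamma> \<circ> f \<circ> \<gamma> | f \<gamma> :: 'a \<Rightarrow> 'a. f \<in> G \<and> bij \<gamma>}" by blast
next
  fix f assume "f \<in> {inv_into UNIV \<gamma> \<circ> f \<circ> \<gamma> | f \<gamma> :: 'a \<Rightarrow> 'a. f \<in> G \<and> bij \<gamma>}"
  then show "f \<in> G" using assms bij_imp_bij_inv by blast
qed

lemma bij_mem_if_symmetric_precomplete:
  fixes G :: "('a \<Rightarrow> 'a) set"
  assumes inf: "infinite (UNIV :: 'a set)" and sym: "symmetric G" and pre: "precomplete G"
    and \<pi>: "bij \<pi>"
  shows "\<pi> \<in> G"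
proof (rule ccontr)
  assume notin: "\<pi> \<notin> G"
  have id: "id \<in> G" and comp: "\<And>f g. f \<in> G \<Longrightarrow> g \<in> G \<Longrightarrow> f \<circ> g \<in> G"
    using pre unfolding precomplete_def submonoid_full_trans_monoid_iff by blast+
  define H where "H = {g \<circ> \<gamma> | g \<gamma> :: 'a \<Rightarrow> 'a. g \<in> G \<and> bij \<gamma>}"
  have HI: "g \<circ> \<gamma> \<in> H" if "g \<in> G" "bij \<gamma>" for g \<gamma> :: "'a \<Rightarrow> 'a" using that unfolding H_def by blast
  have Hcomp: "f1 \<circ> f2 \<in> H" if "f1 \<in> H" "f2 \<in> H" for f1 f2 :: "'a \<Rightarrow> 'a"
  proof -
    obtain g1 \<gamma>1 where 1: "f1 = g1 \<circ> \<gamma>1" "g1 \<in> G" "bij \<gamma>1"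
      using \<open>f1 \<in> H\<close> unfolding H_def by blast
    obtain g2 \<gamma>2 where 2: "f2 = g2 \<circ> \<gamma>2" "g2 \<in> G" "bij \<gamma>2"
      using \<open>f2 \<in> H\<close> unfolding H_def by blast
    note f = 1(1) 2(1) 1(2) 2(2) and b = 1(3) 2(3)
    \<comment> \<open>Symmetry lets \<open>\<gamma>1\<close> move past \<open>g2\<close> at the
      price of a conjugation, which makes \<open>H\<close> a monoid.\<close>
    have "inv_into UNIV (inv_into UNIV \<gamma>1) \<circ> g2 \<circ> inv_into UNIV \<gamma>1 \<in> G"
      using symmetric_conj[OF sym f(4) bij_imp_bij_inv[OF b(1)]] .
    then have "g1 \<circ> (\<gamma>1 \<circ> g2 \<circ> inv_into UNIV \<gamma>1) \<in> G"
      using f(3) comp b(1) by (simp add: inv_inv_eq)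
    then have "g1 \<circ> (\<gamma>1 \<circ> g2 \<circ> inv_into UNIV \<gamma>1) \<circ> (\<gamma>1 \<circ> \<gamma>2) \<in> H"
      using b by (intro HI bij_comp)
    also have "g1 \<circ> (\<gamma>1 \<circ> g2 \<circ> inv_into UNIV \<gamma>1) \<circ> (\<gamma>1 \<circ> \<gamma>2) = f1 \<circ> f2"
      using b(1) by (auto simp: f fun_eq_iff bij_is_inj)
    finally show ?thesis .
  qed
  have "id \<in> H" using HI[OF id bij_id] by simp
  moreover have "G \<subseteq> H" using HI[OF _ bij_id] by auto
  moreover have "\<pi> \<in> H" using HI[OF id \<pi>] by simp
  ultimately have "H = UNIV"
    using precomplete_maximal[OF pre _ Hcomp] notin by blast
  then have fac: "\<exists>g\<in>G. \<exists>\<gamma>. bij \<gamma> \<and> g = f \<circ> \<gamma>" for f :: "'a \<Rightarrow> 'a"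
  proof -
    obtain g \<gamma> :: "'a \<Rightarrow> 'a" where g: "g \<in> G" "bij \<gamma>" "f = g \<circ> \<gamma>"
      using \<open>H = UNIV\<close> unfolding H_def by blast
    have "g = f \<circ> inv_into UNIV \<gamma>" using g(2) by (auto simp: g(3) fun_eq_iff bij_is_surj surj_f_inv_f)
    then show ?thesis using g(1,2) bij_imp_bij_inv by blast
  qed
  text \<open>\<open>\<pi>\<close> factors as \<open>a \<circ> c \<circ> b'\<close>, where \<open>b'\<close> and \<open>c\<close> are conjugates of one injection
    and \<open>a\<close> has a section \<open>t\<close> whose range is disjoint from that of \<open>b'\<close>.\<close>
  obtain A :: "'a set" where A: "\<not> small A" "\<not> small (- A)"
    using not_small_split[OF inf not_small_UNIV] by (metis Compl_eq_Diff_UNIV)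
  obtain i :: "'a \<Rightarrow> 'a" where i: "inj i" "range i = - A"
    using not_small_ex_inj_range[OF A(2)] by blast
  obtain b \<gamma> where b: "b \<in> G" "bij \<gamma>" "b = i \<circ> \<gamma>" using fac by blast
  have b_inj: "inj b" unfolding b(3) using i(1) b(2) bij_is_inj by (intro inj_compose) auto
  have "range b = - A" unfolding b(3) using i(2) b(2) by (metis bij_is_surj image_comp)
  then have cob: "\<not> small (- range b)" and rb: "\<not> small (range b)" using A by simp_all
  obtain a \<delta> where a: "a \<in> G" "bij \<delta>" "a = inv_into UNIV i \<circ> \<delta>" using fac by blast
  define t where "t = inv_into UNIV \<delta> \<circ> i"
  have at: "a (t x) = x" for x
    unfolding a(3) t_def using a(2) i(1) by (simp add: bij_is_surj surj_f_inv_f)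
  have t_inj: "inj t" using at by (metis injI)
  have "range t = inv_into UNIV \<delta> ` (- A)" unfolding t_def i(2)[symmetric] by (rule image_comp[symmetric])
  then have "- range t = inv_into UNIV \<delta> ` A"
    using bij_image_Compl_eq[OF bij_imp_bij_inv[OF a(2)]] by simp
  then have cot: "\<not> small (- range t)"
    using not_small_inj_image[OF A(1)] bij_is_inj[OF bij_imp_bij_inv[OF a(2)]] inj_on_subset subset_UNIV
    by metis
  \<comment> \<open>\<open>T\<close> becomes the range of \<open>b'\<close>; the other half of
    \<open>- range t\<close> is the room that \<open>ex_conj_extending\<close> demands.\<close>
  obtain T where T: "T \<subseteq> - range t" "\<not> small T" "\<not> small (- range t - T)"
    using not_small_split[OF inf cot] by blast
  have "\<not> small (- T)" using T(1) not_small_range[OF t_inj] small_subset by blast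
  then obtain \<epsilon> where \<epsilon>: "bij \<epsilon>" "\<epsilon> ` T = range b"
    using bij_carrying[OF not_small_ordIso_both[OF T(2) rb]] cob by blast
  define b' where "b' = inv_into UNIV \<epsilon> \<circ> b \<circ> \<epsilon>"
  have b': "b' \<in> G" unfolding b'_def using symmetric_conj[OF sym b(1) \<epsilon>(1)] .
  have b'_inj: "inj b'"
    unfolding b'_def using \<epsilon>(1) b_inj bij_is_inj bij_imp_bij_inv by (intro inj_compose) blast+
  have "range b' = inv_into UNIV \<epsilon> ` b ` range \<epsilon>" unfolding b'_def by (simp add: image_comp)
  also have "\<dots> = T" using \<epsilon> by (metis bij_is_inj bij_is_surj image_inv_f_f)
  finally have rb': "range b' = T" .
  \<comment> \<open>This bijection takes \<open>b' x\<close> to \<open>t (\<pi> x)\<close>; a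
    conjugate of \<open>b\<close> that extends it, preceded by \<open>b'\<close> and followed by
    \<open>a\<close>, gives \<open>\<pi>\<close>.\<close>
  have "bij_betw (t \<circ> \<pi> \<circ> inv_into UNIV b') T (range t)"
  proof (rule bij_betwI[where g = "b' \<circ> inv_into UNIV \<pi> \<circ> a"])
    show "b' \<circ> inv_into UNIV \<pi> \<circ> a \<in> range t \<rightarrow> T" using rb' by auto
  qed (use \<pi> b'_inj rb' in \<open>auto simp: at bij_is_inj bij_is_surj surj_f_inv_f f_inv_into_f\<close>)
  moreover have "T \<inter> range t = {}" "\<not> small (- (T \<union> range t))"
  proof -
    have "- (T \<union> range t) = - range t - T" by blast
    then show "\<not> small (- (T \<union> range t))" using T(3) by simp
  qed (use T(1) in blast)
  ultimately obtain \<eta> where \<eta>: "bij \<eta>"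
    "\<And>y. y \<in> T \<Longrightarrow> (inv_into UNIV \<eta> \<circ> b \<circ> \<eta>) y = (t \<circ> \<pi> \<circ> inv_into UNIV b') y"
    using ex_conj_extending[OF b_inj cob, of "t \<circ> \<pi> \<circ> inv_into UNIV b'" T "range t"] T(2) by blast
  let ?c = "inv_into UNIV \<eta> \<circ> b \<circ> \<eta>"
  have "?c (b' x) = t (\<pi> x)" for x using \<eta>(2)[of "b' x"] rb' b'_inj by auto
  then have "a \<circ> (?c \<circ> b') = \<pi>" using at by (auto simp: fun_eq_iff)
  moreover have "?c \<in> G" using symmetric_conj[OF sym b(1) \<eta>(1)] .
  ultimately have "\<pi> \<in> G" using comp a(1) b' by metis
  then show False using notin by blast
qed

section \<open>Reduction to closure, incomparability and generation\<close>

text \<open>By \<open>gen\<close>, a symmetric precomplete monoid lies in a member of the list and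
  equals it by maximality. Conversely, a monoid strictly above \<open>M\<close> lies in no member
  \<open>N\<close>, since that would put \<open>M\<close> strictly below \<open>N\<close>.\<close>

lemma symmetric_precomplete_eq:
  fixes \<L> :: "('a \<Rightarrow> 'a) set set"
  assumes inf: "infinite (UNIV :: 'a set)"
    and comp: "\<And>M f g. M \<in> \<L> \<Longrightarrow> f \<in> M \<Longrightarrow> g \<in> M \<Longrightarrow> f \<circ> g \<in> M"
    and bij: "\<And>M \<pi>. M \<in> \<L> \<Longrightarrow> bij \<pi> \<Longrightarrow> \<pi> \<in> M"
    and proper: "\<And>M. M \<in> \<L> \<Longrightarrow> M \<noteq> UNIV"
    and antichain: "\<And>M N. M \<in> \<L> \<Longrightarrow> N \<in> \<L> \<Longrightarrow> M \<subseteq> N \<Longrightarrow> M = N"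
    and gen: "\<And>G. perm_monoid G \<Longrightarrow> (\<And>M. M \<in> \<L> \<Longrightarrow> \<not> G \<subseteq> M) \<Longrightarrow> G = UNIV"
  shows "{G. symmetric G \<and> precomplete G} = \<L>"
proof (intro equalityI subsetI CollectI)
  fix G assume "G \<in> {G :: ('a \<Rightarrow> 'a) set. symmetric G \<and> precomplete G}"
  then have G: "symmetric G" "precomplete G" by auto
  then have sub: "submonoid G full_trans_monoid" and "G \<noteq> UNIV"
    unfolding precomplete_iff by blast+
  have "perm_monoid G"
    using sub bij_mem_if_symmetric_precomplete[OF inf G] inf
    unfolding submonoid_full_trans_monoid_iff by unfold_locales auto
  then obtain M where M: "M \<in> \<L>" "G \<subseteq> M" using gen \<open>G \<noteq> UNIV\<close> by blast
  have "G = M"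
  proof (rule ccontr)
    assume "G \<noteq> M"
    then have "M = UNIV"
      using precomplete_maximal[OF G(2), of M] comp[OF M(1)] bij[OF M(1) bij_id] M(2) by blast
    then show False using proper[OF M(1)] by blast
  qed
  then show "G \<in> \<L>" using M(1) by simp
next
  fix M assume M: "M \<in> \<L>"
  have "H = UNIV" if H: "submonoid H full_trans_monoid" "M \<subset> H" for H
  proof (rule gen)
    show "perm_monoid H"
      using H bij[OF M] inf unfolding submonoid_full_trans_monoid_iff by unfold_locales auto
    show "\<not> H \<subseteq> N" if "N \<in> \<L>" for N using antichain[OF M that] H(2) by blast
  qed
  moreover have "submonoid M full_trans_monoid"
    unfolding submonoid_full_trans_monoid_iff using comp[OF M] bij[OF M bij_id] by blast
  ultimately have "precomplete M" unfolding precomplete_iff using proper[OF M] by blast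
  then show "symmetric M \<and> precomplete M" using symmetric_if_bij_mem[OF comp[OF M] bij[OF M]] by blast
qed

section \<open>Closure and membership for the families G and M\<close>

text \<open>If \<open>C\<close> is deleted, \<open>g\<close> misses a set \<open>D\<close> of size
  |L|, so the composite only sees \<open>f\<close> with \<open>D\<close> deleted.\<close>

lemma monoid_G_comp:
  fixes L :: "'a set" and f g :: "'a \<Rightarrow> 'a"
  assumes "f \<in> monoid_G |L|" "g \<in> monoid_G |L|"
  shows "f \<circ> g \<in> monoid_G |L|"
proof (rule ccontr)
  assume "f \<circ> g \<notin> monoid_G |L|"
  then obtain C where C: "|C| =o |L|" "|- (f \<circ> g) ` (- C)| <o |L|"
    unfolding not_in_monoid_G by blast
  then have "|L| \<le>o |- g ` (- C)|"
    using assms(2) not_in_monoid_G[of g L] ordLeq_iff_not_ordLess by blast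
  then obtain D where D: "D \<subseteq> - g ` (- C)" "|D| =o |L|" using ordLeq_subset by blast
  then have "|L| \<le>o |- f ` (- D)|"
    using assms(1) not_in_monoid_G[of f L] ordLeq_iff_not_ordLess by blast
  moreover have "- f ` (- D) \<subseteq> - (f \<circ> g) ` (- C)" using D(1) by auto
  ultimately have "|L| \<le>o |- (f \<circ> g) ` (- C)|"
    using card_of_mono1 ordLeq_transitive by blast
  then show False using C(2) not_ordLess_ordLeq by blast
qed

text \<open>This excludes the finite indices above 1, for which it fails.\<close>

lemma index_set_Un_ordLess:
  assumes "index_set L" "|A| <o |L|" "|B| <o |L|"
  shows "|A \<union> B| <o |L|"
proof (cases "finite L")
  case True
  then obtain x where "L = {x}" using assms(1) unfolding index_set_def by blast
  then show ?thesis using assms(2,3) by (simp add: ordLess_singleton_iff)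
qed (use assms card_of_Un_ordLess_infinite in blast)

text \<open>If the composite is injective off a set smaller than \<open>L\<close>, so is
  \<open>g\<close>, which is then almost onto. Hence \<open>f\<close> is also injective off a set
  smaller than \<open>L\<close> and almost onto, and so is the composite.\<close>

lemma monoid_M_comp:
  fixes L :: "'a set" and f g :: "'a \<Rightarrow> 'a"
  assumes L: "index_set L" and f: "f \<in> monoid_M |L|" and g: "g \<in> monoid_M |L|"
  shows "f \<circ> g \<in> monoid_M |L|"
proof (rule ccontr)
  assume "f \<circ> g \<notin> monoid_M |L|"
  then obtain C where C: "|C| <o |L|" "inj_on (f \<circ> g) (- C)" "|L| \<le>o |- range (f \<circ> g)|"
    unfolding not_in_monoid_M by blast
  have "inj_on g (- C)" using C(2) inj_on_imageI2 by blast
  then have cog: "|- range g| <o |L|"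
    using g C(1) not_in_monoid_M[of g L] ordLeq_iff_not_ordLess by blast
  have "|g ` C| <o |L|" using C(1) card_of_image ordLeq_ordLess_trans by blast
  then have "|- range g \<union> g ` C| <o |L|" using index_set_Un_ordLess[OF L cog] by blast
  moreover have "- g ` (- C) \<subseteq> - range g \<union> g ` C" by auto
  ultimately have D: "|- g ` (- C)| <o |L|" using card_of_mono1 ordLeq_ordLess_trans by blast
  have "inj_on f (- (- g ` (- C)))" using C(2) inj_on_imageI by auto
  then have "|- range f| <o |L|"
    using f D not_in_monoid_M[of f L] ordLeq_iff_not_ordLess by blast
  moreover have "|f ` (- range g)| <o |L|" using cog card_of_image ordLeq_ordLess_trans by blast
  ultimately have "|- range f \<union> f ` (- range g)| <o |L|" using index_set_Un_ordLess[OF L] by blast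
  moreover have "- range (f \<circ> g) \<subseteq> - range f \<union> f ` (- range g)" by auto
  ultimately have "|- range (f \<circ> g)| <o |L|" using card_of_mono1 ordLeq_ordLess_trans by blast
  then show False using C(3) not_ordLess_ordLeq by blast
qed

lemma inj_mem_monoid_G:
  fixes L :: "'a set" and f :: "'a \<Rightarrow> 'a"
  assumes "inj f"
  shows "f \<in> monoid_G |L|"
proof (rule ccontr)
  assume "f \<notin> monoid_G |L|"
  then obtain C where C: "|C| =o |L|" "|- f ` (- C)| <o |L|" unfolding not_in_monoid_G by blast
  have "f ` C \<subseteq> - f ` (- C)" using assms by (auto dest: injD)
  then have "|C| \<le>o |- f ` (- C)|" using assms card_of_ordLeq inj_on_subset subset_UNIV by metis
  then have "|C| <o |L|" using C(2) ordLeq_ordLess_trans by blast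
  then show False using C(1) not_ordLess_ordIso by blast
qed

lemma co_range_mem_monoid_G:
  fixes L :: "'a set" and f :: "'a \<Rightarrow> 'a"
  assumes "|L| \<le>o |- range f|"
  shows "f \<in> monoid_G |L|"
proof (rule ccontr)
  assume "f \<notin> monoid_G |L|"
  then obtain C where C: "|- f ` (- C)| <o |L|" unfolding not_in_monoid_G by blast
  have "- range f \<subseteq> - f ` (- C)" by auto
  then have "|L| \<le>o |- f ` (- C)|" using assms card_of_mono1 ordLeq_transitive by blast
  then show False using C not_ordLess_ordLeq by blast
qed

lemma surj_mem_monoid_M:
  fixes L :: "'a set" and f :: "'a \<Rightarrow> 'a"
  assumes "index_set L" "surj f"
  shows "f \<in> monoid_M |L|"
  using empty_ordLess[OF index_set_nonempty[OF assms(1)]] assms(2)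
  unfolding monoid_M_def card_surjective_def by simp

section \<open>Closure and membership for the fibre monoids\<close>

lemma almost_all_iff: "almost_all P \<longleftrightarrow> small {x. \<not> P x}"
proof
  assume "almost_all P"
  then obtain S where S: "small (UNIV - S)" "\<forall>x\<in>S. P x"
    unfolding almost_all_def co_small_def by blast
  have "{x. \<not> P x} \<subseteq> UNIV - S" using S(2) by blast
  then show "small {x. \<not> P x}" using S(1) small_subset by blast
next
  assume s: "small {x. \<not> P x}"
  have "UNIV - {x. P x} = {x. \<not> P x}" by blast
  then have "co_small {x. P x}" using s unfolding co_small_def by simp
  then show "almost_all P" unfolding almost_all_def by blast
qed

lemma monoid_A_iff: "f \<in> monoid_A \<longleftrightarrow> small {y. \<not> small (f -` {y})}"
  unfolding monoid_A_def almost_all_iff by simp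

lemma monoid_A'_iff:
  fixes f :: "'a \<Rightarrow> 'a"
  shows "f \<in> monoid_A' \<longleftrightarrow> (\<exists>T :: 'a set. small T \<and> small {y. \<not> |f -` {y}| \<le>o |T|})"
proof
  assume "f \<in> monoid_A'"
  then obtain \<mu> :: "'a rel" where \<mu>: "Card_order \<mu>" "\<mu> <o |UNIV :: 'a set|"
    "small {y. \<not> |f -` {y}| \<le>o \<mu>}"
    unfolding monoid_A'_def almost_all_iff by blast
  have iso: "|Field \<mu>| =o \<mu>" using card_of_Field_ordIso[OF \<mu>(1)] .
  then have "|f -` {y}| \<le>o \<mu> \<longleftrightarrow> |f -` {y}| \<le>o |Field \<mu>|" for y
    using ordLeq_ordIso_trans[of "|f -` {y}|"] ordIso_symmetric[OF iso] by blast
  then have "small {y. \<not> |f -` {y}| \<le>o |Field \<mu>|}" using \<mu>(3) by simp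
  moreover have "small (Field \<mu>)"
    unfolding small_def using ordIso_ordLess_trans[OF iso \<mu>(2)] .
  ultimately show "\<exists>T :: 'a set. small T \<and> small {y. \<not> |f -` {y}| \<le>o |T|}" by blast
next
  assume "\<exists>T :: 'a set. small T \<and> small {y. \<not> |f -` {y}| \<le>o |T|}"
  then show "f \<in> monoid_A'"
    unfolding monoid_A'_def almost_all_iff small_def[of "_ :: 'a set"]
    using card_of_Card_order by blast
qed

lemma monoid_A'_subset_monoid_A: "monoid_A' \<subseteq> monoid_A"
proof
  fix f :: "'a \<Rightarrow> 'a" assume "f \<in> monoid_A'"
  then obtain T :: "'a set" where T: "small T" "small {y. \<not> |f -` {y}| \<le>o |T|}"
    unfolding monoid_A'_iff by blast
  have "{y. \<not> small (f -` {y})} \<subseteq> {y. \<not> |f -` {y}| \<le>o |T|}"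
    using small_ordLeq[OF T(1)] by blast
  then show "f \<in> monoid_A" unfolding monoid_A_iff using T(2) small_subset by blast
qed

lemma comp_vimage_singleton: "(f \<circ> g) -` {y} = (\<Union>z\<in>f -` {y}. g -` {z})"
  by auto

context
  assumes inf: "infinite (UNIV :: 'a set)"
begin

lemma fibres_bounded_mem_monoid_A':
  fixes f :: "'a \<Rightarrow> 'a"
  assumes "small (T :: 'a set)" "\<And>y. |f -` {y}| \<le>o |T|"
  shows "f \<in> monoid_A'"
  unfolding monoid_A'_iff using assms finite_small[OF inf, of "{}"] by auto

lemma inj_mem_monoid_A':
  fixes f :: "'a \<Rightarrow> 'a"
  assumes "inj f"
  shows "f \<in> monoid_A'"
proof (rule fibres_bounded_mem_monoid_A'[of "{undefined}"])
  show "|f -` {y}| \<le>o |{undefined :: 'a}|" for y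
  proof (rule card_of_ordLeqI[of "\<lambda>_. undefined"])
    show "inj_on (\<lambda>_. undefined :: 'a) (f -` {y})"
      using assms by (auto simp: inj_on_def dest: injD)
  qed simp
qed (simp add: finite_small[OF inf])

text \<open>By regularity a small union of small fibres is small. The remaining values have a large
  \<open>f\<close>-fibre or are \<open>f\<close>-images of points with large
  \<open>g\<close>-fibre.\<close>

lemma monoid_A_comp:
  fixes f g :: "'a \<Rightarrow> 'a"
  assumes reg: "regularCard |UNIV :: 'a set|" and f: "f \<in> monoid_A" and g: "g \<in> monoid_A"
  shows "f \<circ> g \<in> monoid_A"
proof -
  have "stable |UNIV :: 'a set|"
    by (rule regularCard_stable) (simp_all add: reg Field_card_of inf card_of_card_order_on)
  then have "small ((f \<circ> g) -` {y})" if "small (f -` {y})" "\<And>z. z \<in> f -` {y} \<Longrightarrow> small (g -` {z})" for y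
    unfolding comp_vimage_singleton using that unfolding small_def
    by (intro card_of_UNION_ordLess_infinite) auto
  then have "{y. \<not> small ((f \<circ> g) -` {y})} \<subseteq> {y. \<not> small (f -` {y})} \<union> f ` {z. \<not> small (g -` {z})}"
    by blast
  moreover have "small ({y. \<not> small (f -` {y})} \<union> f ` {z. \<not> small (g -` {z})})"
    using f g small_Un[OF inf] small_image unfolding monoid_A_iff by blast
  ultimately show ?thesis unfolding monoid_A_iff using small_subset by blast
qed

lemma infinite_small_if_singular:
  assumes "\<not> regularCard |UNIV :: 'a set|"
  obtains N :: "'a set" where "infinite N" "small N"
proof -
  have "\<exists>N :: 'a set. infinite N \<and> small N"
  proof (rule ccontr)
    assume "\<nexists>N :: 'a set. infinite N \<and> small N"
    then have fin: "small S \<longleftrightarrow> finite S" for S :: "'a set" using finite_small[OF inf] by blast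
    have "stable |UNIV :: 'a set|"
      unfolding stable_def
    proof (intro allI impI, elim conjE)
      fix A :: "'a set" and F :: "'a \<Rightarrow> 'a set"
      assume "|A| <o |UNIV :: 'a set|" "\<forall>a\<in>A. |F a| <o |UNIV :: 'a set|"
      then have "finite (Sigma A F)" using fin unfolding small_def by auto
      then show "|Sigma A F| <o |UNIV :: 'a set|" using inf card_of_finite_ordLess by blast
    qed
    then have "regularCard |UNIV :: 'a set|"
      by (intro stable_regularCard) (simp_all add: Field_card_of inf card_of_card_order_on)
    then show False using assms by blast
  qed
  then show thesis using that by blast
qed

lemma monoid_A'_comp:
  fixes f g :: "'a \<Rightarrow> 'a"
  assumes sing: "\<not> regularCard |UNIV :: 'a set|" and f: "f \<in> monoid_A'" and g: "g \<in> monoid_A'"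
  shows "f \<circ> g \<in> monoid_A'"
proof -
  obtain T U :: "'a set" where T: "small T" "small {y. \<not> |f -` {y}| \<le>o |T|}"
    and U: "small U" "small {y. \<not> |g -` {y}| \<le>o |U|}"
    using f g unfolding monoid_A'_iff by blast
  obtain N :: "'a set" where N: "infinite N" "small N"
    using infinite_small_if_singular[OF sing] by blast
  \<comment> \<open>\<open>N\<close> makes the common bound infinite, so that at most |V| sets of
    size at most |V| have a union of size at most |V|.\<close>
  define V where "V = T \<union> U \<union> N"
  have V: "infinite V" "small V" unfolding V_def using N T(1) U(1) small_Un[OF inf] by auto
  have TV: "|T| \<le>o |V|" and UV: "|U| \<le>o |V|" unfolding V_def by (rule card_of_mono1; blast)+
  have "|(f \<circ> g) -` {y}| \<le>o |V|"
    if "|f -` {y}| \<le>o |T|" "\<And>z. z \<in> f -` {y} \<Longrightarrow> |g -` {z}| \<le>o |U|" for y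
    unfolding comp_vimage_singleton
  proof (rule card_of_UNION_ordLeq_infinite[OF V(1)])
    show "|f -` {y}| \<le>o |V|" using ordLeq_transitive[OF that(1) TV] .
    show "\<forall>z\<in>f -` {y}. |g -` {z}| \<le>o |V|" using ordLeq_transitive[OF that(2) UV] by blast
  qed
  then have "{y. \<not> |(f \<circ> g) -` {y}| \<le>o |V|}
      \<subseteq> {y. \<not> |f -` {y}| \<le>o |T|} \<union> f ` {z. \<not> |g -` {z}| \<le>o |U|}"
    by blast
  moreover have "small ({y. \<not> |f -` {y}| \<le>o |T|} \<union> f ` {z. \<not> |g -` {z}| \<le>o |U|})"
    using T U small_Un[OF inf] small_image by blast
  ultimately have "small {y. \<not> |(f \<circ> g) -` {y}| \<le>o |V|}" using small_subset by blast
  then show ?thesis unfolding monoid_A'_iff using V(2) by blast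
qed

section \<open>Test functions that separate the listed monoids\<close>

lemma ex_inj_large_co_range:
  obtains i :: "'a \<Rightarrow> 'a" where "inj i" "\<not> small (- range i)"
proof -
  obtain A :: "'a set" where A: "\<not> small A" "\<not> small (- A)"
    using not_small_split[OF inf not_small_UNIV] by (metis Compl_eq_Diff_UNIV)
  obtain i :: "'a \<Rightarrow> 'a" where "inj i" "range i = A"
    using not_small_ex_inj_range[OF A(1)] by blast
  then show thesis using that A(2) by blast
qed

lemma ex_large_fibres:
  obtains s :: "'a \<Rightarrow> 'a" where "\<And>y. \<not> small (s -` {y})"
proof -
  have "|(UNIV :: 'a set) \<times> (UNIV :: 'a set)| =o |UNIV :: 'a set|"
    using card_of_Times_same_infinite[OF inf] .
  then have "\<exists>p. bij_betw p ((UNIV :: 'a set) \<times> (UNIV :: 'a set)) (UNIV :: 'a set)"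
    by (rule card_of_ordIso[THEN iffD2])
  then obtain p :: "'a \<times> 'a \<Rightarrow> 'a" where p: "bij p" unfolding UNIV_Times_UNIV ..
  have "\<not> small ((fst \<circ> inv_into UNIV p) -` {y})" for y
  proof -
    have "inj (\<lambda>x. p (y, x))" by (rule injI) (simp add: inj_eq[OF bij_is_inj[OF p]])
    moreover have "range (\<lambda>x. p (y, x)) \<subseteq> (fst \<circ> inv_into UNIV p) -` {y}"
      by (auto simp: inv_into_f_f[OF bij_is_inj[OF p]])
    ultimately show ?thesis using not_small_range small_subset by blast
  qed
  then show thesis using that by blast
qed

text \<open>The projection from X times \<open>bool\<close> to X has two-point fibres and stays onto
  after the points of \<open>L\<close> tagged \<open>True\<close> are deleted.\<close>

lemma ex_surj_omitting_monoid_A':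
  fixes L :: "'a set"
  obtains q :: "'a \<Rightarrow> 'a" and A where "q \<in> monoid_A'" "|A| =o |L|" "q ` (- A) = UNIV"
proof -
  obtain p :: "'a \<times> bool \<Rightarrow> 'a" where p: "bij p" using bij_UNIV_Times_bool[OF inf] by blast
  note pinj = bij_is_inj[OF p]
  define q where "q = fst \<circ> inv_into UNIV p"
  have qp: "q (p z) = fst z" for z unfolding q_def using pinj by simp
  \<comment> \<open>The bound must be a subset of X, so two distinct points of X stand in for
    \<open>bool\<close>.\<close>
  have "|q -` {y}| \<le>o |{p (undefined, True), p (undefined, False)}|" for y
  proof (rule card_of_ordLeqI[of "\<lambda>x. p (undefined, snd (inv_into UNIV p x))"])
    show "inj_on (\<lambda>x. p (undefined, snd (inv_into UNIV p x))) (q -` {y})"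
    proof (rule inj_onI)
      fix x x' assume x: "x \<in> q -` {y}" "x' \<in> q -` {y}"
        and "p (undefined, snd (inv_into UNIV p x)) = p (undefined, snd (inv_into UNIV p x'))"
      then have "inv_into UNIV p x = inv_into UNIV p x'"
        unfolding q_def by (simp add: inj_eq[OF pinj] prod_eq_iff)
      then show "x = x'" using bij_is_surj[OF p] by (metis surj_f_inv_f)
    qed
    show "p (undefined, snd (inv_into UNIV p x)) \<in> {p (undefined, True), p (undefined, False)}" for x
      by (cases "snd (inv_into UNIV p x)") auto
  qed
  then have "q \<in> monoid_A'" by (rule fibres_bounded_mem_monoid_A'[rotated]) (simp add: finite_small[OF inf])
  moreover have "|(\<lambda>x. p (x, True)) ` L| =o |L|"
  proof (rule ordIso_symmetric, rule card_of_ordIsoI)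
    show "bij_betw (\<lambda>x. p (x, True)) L ((\<lambda>x. p (x, True)) ` L)"
      by (auto simp: bij_betw_def inj_on_def inj_eq[OF pinj])
  qed
  moreover have "q ` (- (\<lambda>x. p (x, True)) ` L) = UNIV"
  proof -
    have "y \<in> q ` (- (\<lambda>x. p (x, True)) ` L)" for y
      by (rule image_eqI[of _ _ "p (y, False)"]) (auto simp: qp inj_eq[OF pinj])
    then show ?thesis by blast
  qed
  ultimately show thesis using that by blast
qed

lemma ordLeq_not_small: "\<not> small (S :: 'a set) \<Longrightarrow> |L :: 'a set| \<le>o |S|"
  using card_of_mono1[OF subset_UNIV, of L] ordLeq_transitive unfolding not_small_iff by blast

lemma large_fibres_not_mem_monoid_A:
  "\<not> small {y :: 'a. \<not> small (f -` {y})} \<Longrightarrow> f \<notin> monoid_A"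
  unfolding monoid_A_iff by blast

lemma large_fibres_not_mem_monoid_G:
  fixes s :: "'a \<Rightarrow> 'a" and L :: "'a set"
  assumes L: "index_set L" and s: "\<And>y. \<not> small (s -` {y})"
  shows "s \<notin> monoid_G |L|"
proof -
  obtain i :: "'a \<Rightarrow> 'a" where i: "inj i" "\<not> small (- range i)" using ex_inj_large_co_range by blast
  have "\<exists>H :: 'a \<Rightarrow> 'a. inj H \<and> range H \<subseteq> s -` {y}" for y using inj_into_not_small[OF s] by metis
  then obtain H :: "'a \<Rightarrow> 'a \<Rightarrow> 'a" where H: "\<And>y. inj (H y)" "\<And>y. range (H y) \<subseteq> s -` {y}"
    by metis
  have sH: "s (H y z) = y" for y z using H(2)[of y] by auto
  have H_eq: "H y z = H y' z' \<longleftrightarrow> y = y' \<and> z = z'" for y y' z z'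
    using sH H(1) by (metis injD)
  let ?C = "(\<lambda>y. H y undefined) ` L"
  \<comment> \<open>A second index in each fibre: \<open>H y x\<close> survives the deletion of
    \<open>H y undefined\<close>.\<close>
  obtain x :: 'a where x: "x \<noteq> undefined" using inf by (metis ex_new_if_finite finite.emptyI finite.insertI insertI1)
  have "bij_betw (\<lambda>y. H y undefined) L ?C" by (auto simp: bij_betw_def inj_on_def H_eq)
  then have "|?C| =o |L|" using card_of_ordIsoI ordIso_symmetric by blast
  moreover have "y \<in> s ` (- ?C)" for y
    by (rule image_eqI[of _ _ "H y x"]) (use x in \<open>auto simp: sH H_eq\<close>)
  then have "- s ` (- ?C) = {}" by blast
  then have "|- s ` (- ?C)| <o |L|" using empty_ordLess[OF index_set_nonempty[OF L]] by metis
  ultimately show ?thesis unfolding not_in_monoid_G by blast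
qed

lemma inj_large_co_range_not_mem_monoid_M:
  fixes i :: "'a \<Rightarrow> 'a" and L :: "'a set"
  assumes "index_set L" "inj i" "\<not> small (- range i)"
  shows "i \<notin> monoid_M |L|"
  unfolding not_in_monoid_M
  using assms(2) empty_ordLess[OF index_set_nonempty[OF assms(1)]] ordLeq_not_small[OF assms(3)]
  by (metis inj_on_subset subset_UNIV)

section \<open>Incomparability of the listed monoids\<close>

lemma monoid_G_not_subset_monoid_M:
  fixes L L' :: "'a set"
  assumes "index_set L'"
  shows "\<not> (monoid_G |L| :: ('a \<Rightarrow> 'a) set) \<subseteq> monoid_M |L'|"
proof -
  obtain i :: "'a \<Rightarrow> 'a" where "inj i" "\<not> small (- range i)" using ex_inj_large_co_range by blast
  then show ?thesis using inj_mem_monoid_G inj_large_co_range_not_mem_monoid_M[OF assms] by blast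
qed

lemma monoid_A'_not_subset_monoid_M:
  fixes L :: "'a set"
  assumes "index_set L"
  shows "\<not> (monoid_A' :: ('a \<Rightarrow> 'a) set) \<subseteq> monoid_M |L|"
proof -
  obtain i :: "'a \<Rightarrow> 'a" where "inj i" "\<not> small (- range i)" using ex_inj_large_co_range by blast
  then show ?thesis using inj_mem_monoid_A' inj_large_co_range_not_mem_monoid_M[OF assms] by blast
qed

lemma monoid_A'_not_subset_monoid_G:
  fixes L :: "'a set"
  assumes "index_set L"
  shows "\<not> (monoid_A' :: ('a \<Rightarrow> 'a) set) \<subseteq> monoid_G |L|"
proof -
  obtain q :: "'a \<Rightarrow> 'a" and A where q: "q \<in> monoid_A'" "|A| =o |L|" "q ` (- A) = UNIV"
    using ex_surj_omitting_monoid_A' by blast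
  have "|- q ` (- A)| <o |L|"
    using q(3) empty_ordLess[OF index_set_nonempty[OF assms]] by simp
  then show ?thesis using q not_in_monoid_G[of q L] by blast
qed

lemma monoid_M_not_subset:
  fixes L :: "'a set"
  assumes "index_set L"
  shows "\<not> (monoid_M |L| :: ('a \<Rightarrow> 'a) set) \<subseteq> monoid_A"
    and "index_set (L' :: 'a set) \<Longrightarrow> \<not> (monoid_M |L| :: ('a \<Rightarrow> 'a) set) \<subseteq> monoid_G |L'|"
proof -
  obtain s :: "'a \<Rightarrow> 'a" where s: "\<And>y. \<not> small (s -` {y})" using ex_large_fibres by blast
  have "s -` {y} \<noteq> {}" for y using s[of y] finite_small[OF inf, of "{}"] by auto
  then have "\<exists>x. y = s x" for y by (metis ex_in_conv vimage_singleton_eq)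
  then have "surj s" unfolding surj_def by blast
  then have sM: "s \<in> monoid_M |L|" using surj_mem_monoid_M[OF assms] by blast
  have "{y. \<not> small (s -` {y})} = UNIV" using s by blast
  then have "s \<notin> monoid_A" using large_fibres_not_mem_monoid_A[of s] not_small_UNIV by metis
  then show "\<not> (monoid_M |L| :: ('a \<Rightarrow> 'a) set) \<subseteq> monoid_A" using sM by blast
  show "\<not> (monoid_M |L| :: ('a \<Rightarrow> 'a) set) \<subseteq> monoid_G |L'|" if "index_set L'"
    using sM large_fibres_not_mem_monoid_G[OF that s] by blast
qed

text \<open>Following a map with large fibres by an injection of large co-range keeps the fibres
  large and puts the composite into every G.\<close>

lemma monoid_G_not_subset_monoid_A:
  fixes L :: "'a set"
  shows "\<not> (monoid_G |L| :: ('a \<Rightarrow> 'a) set) \<subseteq> monoid_A"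
proof -
  obtain s :: "'a \<Rightarrow> 'a" where s: "\<And>y. \<not> small (s -` {y})" using ex_large_fibres by blast
  obtain i :: "'a \<Rightarrow> 'a" where i: "inj i" "\<not> small (- range i)" using ex_inj_large_co_range by blast
  have "- range i \<subseteq> - range (i \<circ> s)" by auto
  then have "\<not> small (- range (i \<circ> s))" using i(2) small_subset by blast
  then have "i \<circ> s \<in> monoid_G |L|" using co_range_mem_monoid_G ordLeq_not_small by blast
  moreover have "(i \<circ> s) -` {i y} = s -` {y}" for y using i(1) by (auto dest: injD)
  then have "range i \<subseteq> {y. \<not> small ((i \<circ> s) -` {y})}" using s by auto
  then have "i \<circ> s \<notin> monoid_A"
    using large_fibres_not_mem_monoid_A[of "i \<circ> s"] not_small_range[OF i(1)] small_subset by blast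
  ultimately show ?thesis by blast
qed

lemma monoid_G_subset_imp_ordIso:
  fixes L L' :: "'a set"
  assumes L: "index_set L" "index_set L'" and sub: "(monoid_G |L| :: ('a \<Rightarrow> 'a) set) \<subseteq> monoid_G |L'|"
  shows "|L| =o |L'|"
proof -
  \<comment> \<open>\<open>j \<circ> q\<close> has range \<open>- L\<close>, and still has it after
    |L'| points are deleted: it misses enough points for \<open>L\<close>, too few for
    \<open>L'\<close>.\<close>
  have False if less: "|L| <o |L'|"
  proof -
    obtain q :: "'a \<Rightarrow> 'a" and A where q: "|A| =o |L'|" "q ` (- A) = UNIV"
      by (rule ex_surj_omitting_monoid_A'[of L'])
    obtain j :: "'a \<Rightarrow> 'a" where j: "inj j" "range j = - L"
      using not_small_ex_inj_range[OF not_small_Compl[OF inf small_ordLess[OF less]]] by blast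
    have rng: "(j \<circ> q) ` (- A) = - L" using q(2) j(2) by (simp only: image_comp[symmetric])
    then have "|- (j \<circ> q) ` (- A)| <o |L'|" using less by simp
    then have "j \<circ> q \<notin> monoid_G |L'|" using q(1) not_in_monoid_G by blast
    moreover have "L \<subseteq> - range (j \<circ> q)" using j(2) by auto
    then have "j \<circ> q \<in> monoid_G |L|" using co_range_mem_monoid_G card_of_mono1 by blast
    ultimately show False using sub by blast
  qed
  \<comment> \<open>The witness collapses \<open>L'\<close> to a point and maps the rest bijectively
    onto X. It can spare \<open>L'\<close>, but being injective off a set smaller than
    \<open>L\<close> it cannot spare |L| points.\<close>
  moreover have False if less: "|L'| <o |L|"
  proof -
    have "infinite L"
      using L less index_set_nonempty[OF L(2)] unfolding index_set_def by (metis ordLess_singleton_iff)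
    have "\<not> small (- L')" using not_small_Compl[OF inf small_ordLess[OF less]] .
    then obtain \<beta> :: "'a \<Rightarrow> 'a" where \<beta>: "bij_betw \<beta> (- L') UNIV"
      using not_small_ordIso_both[OF _ not_small_UNIV] card_of_ordIso by blast
    define f where "f x = (if x \<in> L' then undefined else \<beta> x)" for x
    have inj: "inj_on f (- L')" using \<beta> unfolding bij_betw_def f_def inj_on_def by simp
    have "f ` (- L') = UNIV" using \<beta> unfolding bij_betw_def f_def by simp
    then have "|- f ` (- L')| <o |L'|" using empty_ordLess[OF index_set_nonempty[OF L(2)]] by simp
    then have "f \<notin> monoid_G |L'|" using not_in_monoid_G[of f L'] card_of_refl by blast
    moreover have "f \<in> monoid_G |L|"
    proof (rule ccontr)
      assume "f \<notin> monoid_G |L|"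
      then obtain C where C: "|C| =o |L|" "|- f ` (- C)| <o |L|" unfolding not_in_monoid_G by blast
      have fin: "|{undefined :: 'a}| <o |L|" by (rule card_of_finite_ordLess[OF _ \<open>infinite L\<close>]) simp
      \<comment> \<open>A value taken on \<open>C - L'\<close> can be taken again off
        \<open>C\<close> only at a point of \<open>L'\<close>, and then it is
        \<open>undefined\<close>.\<close>
      have "f ` (C - L') \<subseteq> - f ` (- C) \<union> {undefined}"
        using inj unfolding inj_on_def f_def by auto
      then have "|f ` (C - L')| \<le>o |- f ` (- C) \<union> {undefined}|" by (rule card_of_mono1)
      moreover have "|C - L'| \<le>o |f ` (C - L')|"
        using inj card_of_ordLeq[of "C - L'" "f ` (C - L')"] by (metis Compl_iff Diff_iff inj_on_subset order_refl subsetI)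
      ultimately have "|C - L'| <o |L|"
        using card_of_Un_ordLess_infinite[OF \<open>infinite L\<close> C(2) fin] ordLeq_transitive ordLeq_ordLess_trans by blast
      then have "|C - L' \<union> L'| <o |L|" using card_of_Un_ordLess_infinite[OF \<open>infinite L\<close> _ less] by blast
      moreover have "C \<subseteq> C - L' \<union> L'" by blast
      ultimately have "|C| <o |L|" using card_of_mono1 ordLeq_ordLess_trans by blast
      then show False using C(1) not_ordLess_ordIso by blast
    qed
    ultimately show False using sub by blast
  qed
  ultimately show ?thesis using ordLeq_iff_not_ordLess ordIso_iff_ordLeq by blast
qed

lemma monoid_M_subset_imp_ordIso:
  fixes L L' :: "'a set"
  assumes L: "index_set L" "index_set L'" and sub: "(monoid_M |L| :: ('a \<Rightarrow> 'a) set) \<subseteq> monoid_M |L'|"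
  shows "|L| =o |L'|"
proof -
  have False if less: "|L| <o |L'|"
  proof -
    obtain i :: "'a \<Rightarrow> 'a" where i: "inj i" "\<not> small (- range i)" using ex_inj_large_co_range by blast
    have "- L \<noteq> {}" using not_small_Compl[OF inf small_ordLess[OF less]] finite_small[OF inf, of "{}"] by auto
    then obtain c where c: "c \<notin> L" by blast
    \<comment> \<open>Collapsing \<open>L\<close> together with the extra point \<open>c\<close>
      destroys injectivity even when \<open>L\<close> is a singleton. Off \<open>L\<close> the map
      is injective, so it is injective in the sense of \<open>L'\<close> but not of
      \<open>L\<close>.\<close>
    define f where "f x = (if x \<in> L then i c else i x)" for x
    have "inj_on f (- L)" using i(1) unfolding f_def inj_on_def by simp
    moreover have "- range i \<subseteq> - range f" unfolding f_def by auto
    then have "\<not> small (- range f)" using i(2) small_subset by blast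
    then have "|L'| \<le>o |- range f|" by (rule ordLeq_not_small)
    ultimately have "f \<notin> monoid_M |L'|" using less not_in_monoid_M by blast
    moreover have "f \<in> monoid_M |L|"
    proof (rule ccontr)
      assume "f \<notin> monoid_M |L|"
      then obtain C where C: "|C| <o |L|" "inj_on f (- C)" unfolding not_in_monoid_M by blast
      have one: "x = y" if "x \<in> insert c L - C" "y \<in> insert c L - C" for x y
      proof -
        have "f x = f y" using that by (auto simp: f_def)
        then show ?thesis using C(2) that by (meson Compl_iff DiffD2 inj_onD)
      qed
      show False
      proof (cases "finite L")
        case True
        then obtain l where l: "L = {l}" using L(1) unfolding index_set_def by blast
        then have "C = {}" using C(1) ordLess_singleton_iff by metis
        then show False using one[of l c] l c by simp
      next
        case False
        have "finite (insert c L - C)"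
        proof (cases "insert c L - C = {}")
          case False
          then obtain x where "insert c L - C = {x}" using one by blast
          then show ?thesis by simp
        qed (metis finite.emptyI)
        then have "|insert c L - C| <o |L|" using False card_of_finite_ordLess by blast
        then have "|(insert c L - C) \<union> C| <o |L|" using C(1) card_of_Un_ordLess_infinite[OF False] by blast
        moreover have "L \<subseteq> (insert c L - C) \<union> C" by blast
        ultimately have "|L| <o |L|" using card_of_mono1 ordLeq_ordLess_trans by blast
        then show False using ordLess_irreflexive by blast
      qed
    qed
    ultimately show False using sub by blast
  qed
  moreover have False if less: "|L'| <o |L|"
  proof -
    \<comment> \<open>An injection that misses exactly \<open>L'\<close> is onto in the sense of
      \<open>L\<close> but not of \<open>L'\<close>.\<close>
    obtain j :: "'a \<Rightarrow> 'a" where j: "inj j" "range j = - L'"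
      using not_small_ex_inj_range[OF not_small_Compl[OF inf small_ordLess[OF less]]] by blast
    have cor: "- range j = L'" using j(2) by blast
    have "j \<notin> monoid_M |L'|"
      unfolding not_in_monoid_M cor
      using empty_ordLess[OF index_set_nonempty[OF L(2)]] j(1) ordLeq_refl card_of_Card_order
      by (metis card_of_mono1 inj_on_subset order_refl subset_UNIV)
    moreover have "j \<in> monoid_M |L|"
      using not_in_monoid_M[of j L] less not_ordLess_ordLeq unfolding cor by blast
    ultimately show False using sub by blast
  qed
  ultimately show ?thesis using ordLeq_iff_not_ordLess ordIso_iff_ordLeq by blast
qed

section \<open>Assembly of the regular and the singular case\<close>

text \<open>The monoid \<open>B\<close> stands for \<open>\<A>\<close> or \<open>\<A>'\<close>, according to whether \<open>|X|\<close> is regular.\<close>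

lemma symmetric_precomplete_list:
  fixes B :: "('a \<Rightarrow> 'a) set"
  assumes B: "monoid_A' \<subseteq> B" "B \<subseteq> monoid_A"
    and comp: "\<And>f g. f \<in> B \<Longrightarrow> g \<in> B \<Longrightarrow> f \<circ> g \<in> B"
    and gen: "\<And>G. perm_monoid G \<Longrightarrow> (\<And>L :: 'a set. index_set L \<Longrightarrow> \<not> G \<subseteq> monoid_M |L| ) \<Longrightarrow>
      (\<And>L :: 'a set. index_set L \<Longrightarrow> \<not> G \<subseteq> monoid_G |L| ) \<Longrightarrow> \<not> G \<subseteq> B \<Longrightarrow> G = UNIV"
  shows "{G. symmetric G \<and> precomplete G} =
    {B} \<union> {monoid_G \<nu> | \<nu>. \<nu> \<in> (index_cardinals :: 'a rel set)}
        \<union> {monoid_M \<nu> | \<nu>. \<nu> \<in> (index_cardinals :: 'a rel set)}"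
proof -
  define \<L> where "\<L> = {B} \<union> {monoid_G |L| | L :: 'a set. index_set L} \<union> {monoid_M |L| | L :: 'a set. index_set L}"
  have cases: thesis if "M \<in> \<L>" "M = B \<Longrightarrow> thesis"
    "\<And>L :: 'a set. index_set L \<Longrightarrow> M = monoid_G |L| \<Longrightarrow> thesis"
    "\<And>L :: 'a set. index_set L \<Longrightarrow> M = monoid_M |L| \<Longrightarrow> thesis" for M thesis
    using that unfolding \<L>_def by blast
  have incl: "B \<in> \<L>" "index_set L \<Longrightarrow> monoid_G |L| \<in> \<L>" "index_set L \<Longrightarrow> monoid_M |L| \<in> \<L>" for L :: "'a set"
    unfolding \<L>_def by blast+
  have "{G. symmetric G \<and> precomplete G} = \<L>"
  proof (rule symmetric_precomplete_eq[OF inf])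
    show "f \<circ> g \<in> M" if "M \<in> \<L>" "f \<in> M" "g \<in> M" for M f g
      using that(1) by (rule cases) (use that comp monoid_G_comp monoid_M_comp in blast)+
    show "\<pi> \<in> M" if "M \<in> \<L>" "bij \<pi>" for M \<pi>
      using that(1)
    proof (rule cases)
      show ?thesis if "M = B"
        using that B(1) inj_mem_monoid_A' bij_is_inj[OF \<open>bij \<pi>\<close>] by blast
      show ?thesis if "M = monoid_G |L|" for L :: "'a set"
        using that inj_mem_monoid_G bij_is_inj[OF \<open>bij \<pi>\<close>] by blast
      show ?thesis if "index_set L" "M = monoid_M |L|" for L :: "'a set"
        using that surj_mem_monoid_M bij_is_surj[OF \<open>bij \<pi>\<close>] by blast
    qed
    show "M \<noteq> UNIV" if "M \<in> \<L>" for M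
      using that
    proof (rule cases)
      show ?thesis if "M = B" using that B(2) monoid_G_not_subset_monoid_A by blast
      show ?thesis if "index_set L" "M = monoid_G |L|" for L :: "'a set"
        using that monoid_A'_not_subset_monoid_G by blast
      show ?thesis if "index_set L" "M = monoid_M |L|" for L :: "'a set"
        using that monoid_A'_not_subset_monoid_M by blast
    qed
    \<comment> \<open>Inclusions of \<open>B\<close> in other members are refuted by maps in
      \<open>monoid_A'\<close>, inclusions in \<open>B\<close> by maps outside
      \<open>monoid_A\<close>; so the bounds on \<open>B\<close> suffice.\<close>
    show "M = N" if "M \<in> \<L>" "N \<in> \<L>" "M \<subseteq> N" for M N
      using that(1)
    proof (rule cases)
      assume M: "M = B"
      show ?thesis using that(2)
      proof (rule cases)
        show ?thesis if "index_set L" "N = monoid_G |L|" for L :: "'a set"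
          using that M B(1) \<open>M \<subseteq> N\<close> monoid_A'_not_subset_monoid_G by blast
        show ?thesis if "index_set L" "N = monoid_M |L|" for L :: "'a set"
          using that M B(1) \<open>M \<subseteq> N\<close> monoid_A'_not_subset_monoid_M by blast
      qed (use M in simp)
    next
      fix L :: "'a set" assume L: "index_set L" and M: "M = monoid_G |L|"
      show ?thesis using that(2)
      proof (rule cases)
        show ?thesis if "N = B"
          using that M B(2) \<open>M \<subseteq> N\<close> monoid_G_not_subset_monoid_A by blast
        show ?thesis if "index_set L'" "N = monoid_G |L'|" for L' :: "'a set"
          using monoid_G_subset_imp_ordIso[OF L that(1)] monoid_G_cong M that(2) \<open>M \<subseteq> N\<close> by blast
        show ?thesis if "index_set L'" "N = monoid_M |L'|" for L' :: "'a set"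
          using that M \<open>M \<subseteq> N\<close> monoid_G_not_subset_monoid_M by blast
      qed
    next
      fix L :: "'a set" assume L: "index_set L" and M: "M = monoid_M |L|"
      show ?thesis using that(2)
      proof (rule cases)
        show ?thesis if "N = B"
          using that M B(2) \<open>M \<subseteq> N\<close> monoid_M_not_subset(1)[OF L] by blast
        show ?thesis if "index_set L'" "N = monoid_G |L'|" for L' :: "'a set"
          using that M \<open>M \<subseteq> N\<close> monoid_M_not_subset(2)[OF L] by blast
        show ?thesis if "index_set L'" "N = monoid_M |L'|" for L' :: "'a set"
          using monoid_M_subset_imp_ordIso[OF L that(1)] monoid_M_cong M that(2) \<open>M \<subseteq> N\<close> by blast
      qed
    qed
    show "G = UNIV" if "perm_monoid G" "\<And>M. M \<in> \<L> \<Longrightarrow> \<not> G \<subseteq> M" for G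
      by (rule gen) (use that incl in blast)+
  qed
  moreover have "{monoid_G \<nu> | \<nu>. \<nu> \<in> (index_cardinals :: 'a rel set)} =
      {monoid_G |L| :: ('a \<Rightarrow> 'a) set | L :: 'a set. index_set L}"
    by (rule index_family_eq) (rule monoid_G_cong)
  moreover have "{monoid_M \<nu> | \<nu>. \<nu> \<in> (index_cardinals :: 'a rel set)} =
      {monoid_M |L| :: ('a \<Rightarrow> 'a) set | L :: 'a set. index_set L}"
    by (rule index_family_eq) (rule monoid_M_cong)
  ultimately show ?thesis unfolding \<L>_def by simp
qed

end

theorem theorem6:
  assumes "infinite (UNIV :: 'a set)"
  shows
    "(regularCard |UNIV :: 'a set| \<longrightarrow>
        {G :: ('a \<Rightarrow> 'a) set. symmetric G \<and> precomplete G} =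
          {monoid_A} \<union> {monoid_G \<nu> | \<nu>. \<nu> \<in> (index_cardinals :: 'a rel set)}
                     \<union> {monoid_M \<nu> | \<nu>. \<nu> \<in> (index_cardinals :: 'a rel set)}) \<and>
     (\<not> regularCard |UNIV :: 'a set| \<longrightarrow>
        {G :: ('a \<Rightarrow> 'a) set. symmetric G \<and> precomplete G} =
          {monoid_A'} \<union> {monoid_G \<nu> | \<nu>. \<nu> \<in> (index_cardinals :: 'a rel set)}
                      \<union> {monoid_M \<nu> | \<nu>. \<nu> \<in> (index_cardinals :: 'a rel set)})"
proof (intro conjI impI)
  assume reg: "regularCard |UNIV :: 'a set|"
  show "{G :: ('a \<Rightarrow> 'a) set. symmetric G \<and> precomplete G} =
          {monoid_A} \<union> {monoid_G \<nu> | \<nu>. \<nu> \<in> (index_cardinals :: 'a rel set)}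
                     \<union> {monoid_M \<nu> | \<nu>. \<nu> \<in> (index_cardinals :: 'a rel set)}"
    by (rule symmetric_precomplete_list[OF assms monoid_A'_subset_monoid_A order_refl])
      (use monoid_A_comp[OF assms reg] perm_monoid.eq_UNIV_if_regular in blast)+
next
  assume sing: "\<not> regularCard |UNIV :: 'a set|"
  show "{G :: ('a \<Rightarrow> 'a) set. symmetric G \<and> precomplete G} =
          {monoid_A'} \<union> {monoid_G \<nu> | \<nu>. \<nu> \<in> (index_cardinals :: 'a rel set)}
                      \<union> {monoid_M \<nu> | \<nu>. \<nu> \<in> (index_cardinals :: 'a rel set)}"
    by (rule symmetric_precomplete_list[OF assms order_refl monoid_A'_subset_monoid_A])
      (use monoid_A'_comp[OF assms sing] perm_monoid.eq_UNIV_if_singular[OF _ sing] in blast)+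
qed

end
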